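(* There exist absolute constants $0<c_1<c_2$ such that the following holds. For each $n$ let $N=n(n-1)/2$ and let $F=F_n$ be a distribution on the positive orthant $\mathbb{R}_+^N$, with one coordinate for each pair $e=ij$, $1\le i<j\le n$, having a down-monotone logconcave density. Let $X$ be a random point from $F$, let $\sigma_e^2=\mathbb{E}(X_e^2)$ for every coordinate $e$, and let $\sigma_{\min}=\min_e\sigma_e$ and $\sigma_{\max}=\max_e\sigma_e$. Then, for $p=p(n)$, $$\lim_{n\to\infty}\Pr(G_{F,p}\text{ is connected})=\begin{cases}0 & \text{if } p<\dfrac{c_1\sigma_{\min}}{n},\\[2mm] 1 & \text{if } p>\dfrac{c_2\sigma_{\max}\ln n}{n}.\end{cases}$$
   Context: A function $f:\mathbb{R}^m\to\mathbb{R}_+$ is logconcave if $f(\lambda x+(1-\lambda)y)\ge f(x)^{\lambda}f(y)^{1-\lambda}$ for all $x,y\in\mathbb{R}^m$ and $\lambda\in[0,1]$. A density $f$ supported in the positive orthant $\mathbb{R}_+^m$ is down-monotone if $f(x)\ge f(y)$ for all $x,y\in\mathbb{R}_+^m$ with $x\le y$ coordinatewise. Given a distribution $F$ on $\mathbb{R}_+^N$, $N=n(n-1)/2$, with a coordinate for each pair of vertices in $[n]=\{1,\dots,n\}$, the random graph $G_{F,p}$ has vertex set $[n]$ and is obtained by picking a random point $X$ from $F$ and taking as edges all pairs $ij$ with $X_{ij}\le p$. *)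

theory Defs
  imports "HOL-Probability.Probability" "Graph_Theory.Graph_Theory"
begin

(* Points of R^I, for a finite index set I, are the functions in I \<rightarrow>\<^sub>E UNIV, i.e. the
   points of the product space of I copies of lborel (which is N-dimensional Lebesgue measure
   for card I = N). *)

definition orthant :: "'i set \<Rightarrow> ('i \<Rightarrow> real) set" where
  "orthant I = (I \<rightarrow>\<^sub>E {0..})"

(* The inequality is trivial at l = 0 and l = 1; Isabelle's convention 0 powr 0 = 0 (instead of 1)
   does not change this, since both sides are nonnegative. *)
definition logconcave :: "'i set \<Rightarrow> (('i \<Rightarrow> real) \<Rightarrow> real) \<Rightarrow> bool" where
  "logconcave I f \<longleftrightarrow>
     (\<forall>x \<in> I \<rightarrow>\<^sub>E UNIV. 0 \<le> f x) \<and>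
     (\<forall>x \<in> I \<rightarrow>\<^sub>E UNIV. \<forall>y \<in> I \<rightarrow>\<^sub>E UNIV. \<forall>l \<in> {0..1}.
        f (\<lambda>i\<in>I. l * x i + (1 - l) * y i) \<ge> f x powr l * f y powr (1 - l))"

definition down_monotone :: "'i set \<Rightarrow> (('i \<Rightarrow> real) \<Rightarrow> real) \<Rightarrow> bool" where
  "down_monotone I f \<longleftrightarrow>
     (\<forall>x \<in> orthant I. \<forall>y \<in> orthant I. (\<forall>i\<in>I. x i \<le> y i) \<longrightarrow> f x \<ge> f y)"

definition dm_logconcave_distribution :: "'i set \<Rightarrow> ('i \<Rightarrow> real) measure \<Rightarrow> bool" where
  "dm_logconcave_distribution I F \<longleftrightarrow>
     prob_space F \<and>
     (\<exists>f \<in> borel_measurable (\<Pi>\<^sub>M i\<in>I. lborel).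
        F = density (\<Pi>\<^sub>M i\<in>I. lborel) (\<lambda>x. ennreal (f x)) \<and>
        logconcave I f \<and>
        (\<forall>x \<in> (I \<rightarrow>\<^sub>E UNIV) - orthant I. f x = 0) \<and>
        down_monotone I f)"

definition sigma :: "('i \<Rightarrow> real) measure \<Rightarrow> 'i \<Rightarrow> real" where
  "sigma F e = sqrt (\<integral>x. (x e)\<^sup>2 \<partial>F)"

definition sigma_min :: "'i set \<Rightarrow> ('i \<Rightarrow> real) measure \<Rightarrow> real" where
  "sigma_min I F = Min (sigma F ` I)"

definition sigma_max :: "'i set \<Rightarrow> ('i \<Rightarrow> real) measure \<Rightarrow> real" where
  "sigma_max I F = Max (sigma F ` I)"

definition vertex_pairs :: "nat \<Rightarrow> (nat \<times> nat) set" where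
  "vertex_pairs n = {(i, j). 1 \<le> i \<and> i < j \<and> j \<le> n}"

(* An undirected simple graph is, as in Graph_Theory, a symmetric loop-free digraph: the edge ij
   is the pair of arcs (i,j), (j,i). *)
definition threshold_graph ::
    "nat \<Rightarrow> (nat \<times> nat \<Rightarrow> real) \<Rightarrow> real \<Rightarrow> nat pair_pre_digraph" where
  "threshold_graph n x p =
     \<lparr> pverts = {1..n},
       parcs = (\<Union>(i, j) \<in> {e \<in> vertex_pairs n. x e \<le> p}. {(i, j), (j, i)}) \<rparr>"

definition prob_connected :: "nat \<Rightarrow> (nat \<times> nat \<Rightarrow> real) measure \<Rightarrow> real \<Rightarrow> real" where
  "prob_connected n F p =
     measure F {x \<in> space F. Digraph_Component.connected (with_proj (threshold_graph n x p))}"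

lemma finite_vertex_pairs: "finite (vertex_pairs n)"
  by (rule finite_subset[of _ "{1..n} \<times> {1..n}"]) (auto simp: vertex_pairs_def)

lemma card_vertex_pairs: "card (vertex_pairs n) = n * (n - 1) div 2"
proof -
  have "vertex_pairs n = prod.swap ` (SIGMA j:{1..n}. {1..<j})"
    by (force simp: vertex_pairs_def image_iff)
  then have "card (vertex_pairs n) = card (SIGMA j:{1..n}. {1..<j})"
    by (simp add: card_image)
  also have "\<dots> = (\<Sum>j\<in>{1..n}. j - 1)"
    by simp
  also have "\<dots> = n * (n - 1) div 2"
  proof (induction n)
    case (Suc n)
    then show ?case by (cases n) auto
  qed simp
  finally show ?thesis .
qed

lemma pair_graph_threshold_graph: "pair_graph (threshold_graph n x p)"
proof
  show "finite (parcs (threshold_graph n x p))"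
    using finite_vertex_pairs[of n] by (auto simp: threshold_graph_def)
  show "symmetric (with_proj (threshold_graph n x p))"
    by (auto simp: threshold_graph_def symmetric_def sym_def)
qed (auto simp: threshold_graph_def vertex_pairs_def)

end

theory Submission
  imports Defs
begin

text \<open>
  Write \<open>f\<close> for the density of a marginal on \<open>k\<close> coordinates. By the Prekopa-Leindler inequality (which is
  elementary for decreasing functions) \<open>f\<close> is again down-monotone and midpoint logconcave, so
  \<open>f(x/2)\<^sup>2 \<ge> f(x) f(0)\<close> and hence \<open>\<integral> \<surd>(f f(0)) \<le> 2^k\<close>; down-monotonicity also gives
  \<open>f(x) \<Prod>x\<^sub>i \<le> 1\<close>. All estimates come from comparing these two facts.

  Upper bound on \<open>f(0)\<close>: \<open>\<surd>(f f(0)) \<ge> f \<surd>(f(0) \<Prod>x\<^sub>i)\<close>, and \<open>E \<Prod>\<surd>(X\<^sub>i/\<sigma>\<^sub>i) \<ge> exp(- C k)\<close> by Jensen, so that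
  \<open>f(0) \<Prod>\<sigma>\<^sub>i \<le> C^k\<close>. Thus \<open>k\<close> given edges are all present with probability at most
  \<open>(C p/\<sigma>\<^sub>m\<^sub>i\<^sub>n)^k\<close>, and a union bound over the sets of \<open>n - 1\<close> edges settles the first case.

  Lower bound on \<open>f(0)\<close>: \<open>f(0) \<sigma>^k \<ge> E exp(- \<Sum>X\<^sub>i/\<sigma>) \<ge> exp(- k)\<close>, so \<open>P(all X\<^sub>i \<ge> a) \<le> 2^-k\<close> for \<open>a = C \<sigma>\<close>.
  Moving each coordinate down by \<open>t\<close> at the cost of a factor \<open>1 - t/a\<close> wherever \<open>x\<^sub>i \<le> a\<close>, and expanding
  the resulting product over the subsets of coordinates exceeding \<open>a\<close>, yields
  \<open>P(all X\<^sub>i \<ge> t) \<le> (1 - t/2a)^k\<close>. A union bound over all cuts settles the second case.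
\<close>

section \<open>The Prekopa-Leindler inequality for decreasing functions\<close>

text \<open>The coordinates are dependent and nothing is known about their correlation, so
  probabilities of joint events have to be read off from the density itself; its value at the origin
  is the common yardstick. Of logconcavity only the midpoint inequality is kept, squared to avoid
  roots. A joint tail bound at scale \<sigma> alone would not settle the second case: the relevant
  level is of order \<sigma> ln n / n, where a single edge may be missing with probability near 1,
  and every edge of a cut has to contribute a small gain. Hence the passage from level a down to
  level t, which uses the joint tails of all subsets of the cut. Both Jensen steps are written as
  tangent inequalities for exp, arranged without negative terms, so that they can be integrated in
  \<open>ennreal\<close>. The constants balance against counting: each of n - 1 edges must gain a
  factor 1/(e n) against at most (e n / 2)^(n-1) choices, and a cut with w vertices on its smaller
  side must gain n^(-2w) against at most n^w choices.\<close>

lemma ennreal_four_mult_le_add_squared: "4 * (x * y) \<le> (x + y)\<^sup>2" for x y :: ennreal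
proof (cases x; cases y)
  fix a b :: real assume "0 \<le> a" "x = ennreal a" "0 \<le> b" "y = ennreal b"
  then have "4 * (x * y) = ennreal (4 * (a * b))" "(x + y)\<^sup>2 = ennreal ((a + b)\<^sup>2)"
    by (auto simp: ennreal_mult' ennreal_power simp flip: ennreal_plus)
  moreover have "4 * (a * b) \<le> (a + b)\<^sup>2"
    using sum_squares_bound[of a b] by (simp add: power2_sum)
  ultimately show ?thesis by (simp add: ennreal_leI)
qed (auto simp: power2_eq_square ennreal_top_mult)

text \<open>\<open>W\<close> contains the whole interval from 0 to (s + t)/2, so s + t is at most
  twice the measure of \<open>W\<close> for all s in \<open>A\<close> and t in \<open>B\<close>; and
  a subset of the half-line has measure at most any of its upper bounds. This is one-dimensional
  Brunn-Minkowski in the easy case where one may always move towards 0.\<close>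

lemma emeasure_midpoint_down_set:
  fixes A B W :: "real set"
  assumes [measurable]: "A \<in> sets borel" "B \<in> sets borel" "W \<in> sets borel"
    and A: "A \<subseteq> {0..}" "A \<noteq> {}" and B: "B \<subseteq> {0..}" "B \<noteq> {}"
    and W: "\<And>s t r. s \<in> A \<Longrightarrow> t \<in> B \<Longrightarrow> 0 \<le> r \<Longrightarrow> 2 * r \<le> s + t \<Longrightarrow> r \<in> W"
  shows "emeasure lborel A + emeasure lborel B \<le> 2 * emeasure lborel W"
proof (cases "emeasure lborel W")
  case (real w)
  have st: "s + t \<le> 2 * w" if "s \<in> A" "t \<in> B" for s t
  proof -
    have "0 \<le> s" "0 \<le> t" using that A B by auto
    then have "ennreal ((s + t) / 2) = emeasure lborel {0..(s + t) / 2}" by simp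
    also have "\<dots> \<le> emeasure lborel W"
      using W[OF that] by (intro emeasure_mono) auto
    finally show ?thesis using real by simp
  qed
  have bound: "emeasure lborel C \<le> ennreal (2 * w - t)"
    if [measurable]: "C \<in> sets borel" and C: "C \<subseteq> {0..}" "\<And>s. s \<in> C \<Longrightarrow> s + t \<le> 2 * w" "C \<noteq> {}" for C t
  proof -
    obtain c where c: "c \<in> C" using C(3) by blast
    then have "0 \<le> c" using C(1) by auto
    then have "0 \<le> 2 * w - t" using C(2)[OF c] by auto
    moreover have "emeasure lborel C \<le> emeasure lborel {0..2 * w - t}"
      using C by (intro emeasure_mono) force+
    ultimately show ?thesis by simp
  qed
  obtain t0 where t0: "t0 \<in> B" using B by auto
  have "emeasure lborel A \<le> ennreal (2 * w - t0)"
    using st[OF _ t0] A by (intro bound) auto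
  then obtain \<alpha> where \<alpha>: "emeasure lborel A = ennreal \<alpha>" "0 \<le> \<alpha>"
    by (cases "emeasure lborel A") (auto simp: top_unique)
  \<comment> \<open>With the elements of \<open>A\<close> replaced by its measure \<alpha>, the
    number 2w - \<alpha> becomes an upper bound of \<open>B\<close>, and the same argument applies
    again.\<close>
  have "t + \<alpha> \<le> 2 * w" if t: "t \<in> B" for t
  proof -
    have "emeasure lborel A \<le> ennreal (2 * w - t)"
      using st[OF _ t] A by (intro bound) auto
    moreover have "0 \<le> 2 * w - t"
      using A st[OF _ t] by force
    ultimately show ?thesis using \<alpha> by simp
  qed
  then have le: "emeasure lborel B \<le> ennreal (2 * w - \<alpha>)"
    using B by (intro bound) auto
  have "0 \<le> 2 * w - \<alpha>" using \<open>t0 \<in> B\<close> B \<open>\<And>t. t \<in> B \<Longrightarrow> t + \<alpha> \<le> 2 * w\<close>[OF t0] by force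
  have "emeasure lborel A + emeasure lborel B \<le> ennreal \<alpha> + ennreal (2 * w - \<alpha>)"
    using le \<alpha> by (simp add: add_left_mono)
  also have "\<dots> = ennreal (2 * w)"
    using \<open>0 \<le> 2 * w - \<alpha>\<close> \<alpha> by (subst ennreal_plus[symmetric]) auto
  also have "\<dots> = 2 * emeasure lborel W"
    using real by (simp add: ennreal_mult')
  finally show ?thesis .
qed (simp add: ennreal_mult_top)

text \<open>The levels are scaled by \<open>c\<close>. Choosing \<open>c\<close> separately for each
  function makes superlevel sets of functions of different height comparable at the same
  \<tau>.\<close>

lemma nn_integral_layer_cake:
  fixes u :: "real \<Rightarrow> real"
  assumes [measurable]: "u \<in> borel_measurable borel"
    and u: "\<And>s. 0 \<le> u s" "\<And>s. s < 0 \<Longrightarrow> u s = 0" and c: "0 < c"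
  shows "(\<integral>\<^sup>+s. ennreal (u s) \<partial>lborel) =
    ennreal c * (\<integral>\<^sup>+\<tau>. indicator {0<..} \<tau> * emeasure lborel {s. 0 \<le> s \<and> c * \<tau> < u s} \<partial>lborel)"
proof -
  have "ennreal (u s) = ennreal c * (\<integral>\<^sup>+\<tau>. indicator {(s, \<tau>). 0 < \<tau> \<and> 0 \<le> s \<and> c * \<tau> < u s} (s, \<tau>) \<partial>lborel)" for s
  proof (cases "s < 0")
    case True
    then show ?thesis using u by (simp add: indicator_def)
  next
    case False
    have "(\<integral>\<^sup>+\<tau>. indicator {(s, \<tau>). 0 < \<tau> \<and> 0 \<le> s \<and> c * \<tau> < u s} (s, \<tau>) \<partial>lborel) =
      (\<integral>\<^sup>+\<tau>. indicator {0<..<u s / c} \<tau> \<partial>lborel)"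
      using c False by (intro nn_integral_cong) (auto simp: indicator_def field_simps)
    also have "\<dots> = ennreal (u s / c)"
      using c u by simp
    finally show ?thesis using c u by (simp flip: ennreal_mult)
  qed
  then have "(\<integral>\<^sup>+s. ennreal (u s) \<partial>lborel) =
     ennreal c * (\<integral>\<^sup>+s. (\<integral>\<^sup>+\<tau>. indicator {(s, \<tau>). 0 < \<tau> \<and> 0 \<le> s \<and> c * \<tau> < u s} (s, \<tau>) \<partial>lborel) \<partial>lborel)"
    by (simp add: nn_integral_cmult)
  also have "(\<integral>\<^sup>+s. (\<integral>\<^sup>+\<tau>. indicator {(s, \<tau>). 0 < \<tau> \<and> 0 \<le> s \<and> c * \<tau> < u s} (s, \<tau>) \<partial>lborel) \<partial>lborel)
     = (\<integral>\<^sup>+\<tau>. (\<integral>\<^sup>+s. indicator {(s, \<tau>). 0 < \<tau> \<and> 0 \<le> s \<and> c * \<tau> < u s} (s, \<tau>) \<partial>lborel) \<partial>lborel)"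
    by (intro lborel_pair.Fubini'[symmetric]) measurable
  also have "\<dots> = (\<integral>\<^sup>+\<tau>. indicator {0<..} \<tau> * emeasure lborel {s. 0 \<le> s \<and> c * \<tau> < u s} \<partial>lborel)"
  proof (intro nn_integral_cong)
    fix \<tau> :: real
    have "(\<integral>\<^sup>+s. indicator {(s, \<tau>). 0 < \<tau> \<and> 0 \<le> s \<and> c * \<tau> < u s} (s, \<tau>) \<partial>lborel) =
      (\<integral>\<^sup>+s. indicator {0<..} \<tau> * indicator {s. 0 \<le> s \<and> c * \<tau> < u s} s \<partial>lborel)"
      by (intro nn_integral_cong) (auto simp: indicator_def)
    also have "\<dots> = indicator {0<..} \<tau> * emeasure lborel {s. 0 \<le> s \<and> c * \<tau> < u s}"
      by (simp add: nn_integral_cmult)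
    finally show "(\<integral>\<^sup>+s. indicator {(s, \<tau>). 0 < \<tau> \<and> 0 \<le> s \<and> c * \<tau> < u s} (s, \<tau>) \<partial>lborel) = \<dots>" .
  qed
  finally show ?thesis .
qed

text \<open>Levels are normalised by the maxima \<open>u 0\<close> and \<open>v 0\<close>. For
  \<tau> < 1 both superlevel sets then contain 0 and \<open>emeasure_midpoint_down_set\<close>
  applies; for \<tau> \<ge> 1 both are empty. Without the normalisation one set could be empty and
  the other large, and the additive inequality between measures would fail. The product form follows
  at the end from the arithmetic-geometric mean inequality.\<close>

lemma prekopa_leindler_decreasing:
  fixes u v w :: "real \<Rightarrow> real"
  assumes [measurable]: "u \<in> borel_measurable borel" "v \<in> borel_measurable borel"
      "w \<in> borel_measurable borel"
    and nonneg: "\<And>s. 0 \<le> u s" "\<And>s. 0 \<le> v s" "\<And>s. 0 \<le> w s"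
    and zero: "\<And>s. s < 0 \<Longrightarrow> u s = 0" "\<And>s. s < 0 \<Longrightarrow> v s = 0" "\<And>s. s < 0 \<Longrightarrow> w s = 0"
    and mono: "\<And>s t. 0 \<le> s \<Longrightarrow> s \<le> t \<Longrightarrow> u t \<le> u s" "\<And>s t. 0 \<le> s \<Longrightarrow> s \<le> t \<Longrightarrow> v t \<le> v s"
      "\<And>s t. 0 \<le> s \<Longrightarrow> s \<le> t \<Longrightarrow> w t \<le> w s"
    and mid: "\<And>s t. 0 \<le> s \<Longrightarrow> 0 \<le> t \<Longrightarrow> u s * v t \<le> (w ((s + t) / 2))\<^sup>2"
  shows "(\<integral>\<^sup>+s. ennreal (u s) \<partial>lborel) * (\<integral>\<^sup>+s. ennreal (v s) \<partial>lborel)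
    \<le> (\<integral>\<^sup>+s. ennreal (w s) \<partial>lborel)\<^sup>2"
proof -
  have le0: "g s \<le> g 0" if "\<And>s t. 0 \<le> s \<Longrightarrow> s \<le> t \<Longrightarrow> g t \<le> g s" "\<And>s. s < 0 \<Longrightarrow> g s = 0" "\<And>s. 0 \<le> g s"
    for g :: "real \<Rightarrow> real" and s
    using that(1)[of 0 s] that(2)[of s] that(3)[of 0] by (cases "s < 0") auto
  have u0: "u s \<le> u 0" and v0: "v s \<le> v 0" for s
    using le0[of u] le0[of v] mono zero nonneg by blast+
  show ?thesis
  proof (cases "u 0 = 0 \<or> v 0 = 0")
    case True
    then have "(\<forall>s. u s = 0) \<or> (\<forall>s. v s = 0)"
      using u0 v0 nonneg by (metis order_antisym)
    then show ?thesis by auto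
  next
    case False
    \<comment> \<open>The geometric mean \<open>c\<close> is the level of \<open>w\<close> that
      \<open>mid\<close> yields from the levels \<open>a\<close> of \<open>u\<close> and
      \<open>b\<close> of \<open>v\<close>.\<close>
    define a b c where "a = u 0" and "b = v 0" and "c = sqrt (a * b)"
    have pos: "0 < a" "0 < b" "0 < c"
      using False nonneg[of 0] by (auto simp: a_def b_def c_def less_le)
    define U V W where "U \<tau> = emeasure lborel {s. 0 \<le> s \<and> a * \<tau> < u s}"
      and "V \<tau> = emeasure lborel {s. 0 \<le> s \<and> b * \<tau> < v s}"
      and "W \<tau> = emeasure lborel {s. 0 \<le> s \<and> c * \<tau> < w s}" for \<tau>
    have [measurable]: "U \<in> borel_measurable borel" "V \<in> borel_measurable borel" "W \<in> borel_measurable borel"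
      unfolding U_def V_def W_def by measurable
    define u1 v1 w1 where "u1 = (\<integral>\<^sup>+\<tau>. indicator {0<..} \<tau> * U \<tau> \<partial>lborel)"
      and "v1 = (\<integral>\<^sup>+\<tau>. indicator {0<..} \<tau> * V \<tau> \<partial>lborel)"
      and "w1 = (\<integral>\<^sup>+\<tau>. indicator {0<..} \<tau> * W \<tau> \<partial>lborel)"
    have "(U \<tau> + V \<tau>) \<le> 2 * W \<tau>" if "0 < \<tau>" for \<tau>
    proof (cases "\<tau> < 1")
      case False
      then have "a * 1 \<le> a * \<tau>" "b * 1 \<le> b * \<tau>" using pos by (intro mult_left_mono; simp)+
      then have "\<not> a * \<tau> < u s" "\<not> b * \<tau> < v s" for s
        using u0[of s] v0[of s] by (auto simp: a_def b_def)
      then show ?thesis by (simp add: U_def V_def)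
    next
      case True
      have "a * \<tau> < a" "b * \<tau> < b" using True pos by auto
      have *: "c * \<tau> < w r"
        if "0 \<le> s" "a * \<tau> < u s" "0 \<le> t" "b * \<tau> < v t" "0 \<le> r" "2 * r \<le> s + t" for s t r
      proof -
        have "(c * \<tau>)\<^sup>2 = (a * \<tau>) * (b * \<tau>)"
          using pos by (simp add: c_def power_mult_distrib) (simp add: power2_eq_square)
        also have "\<dots> < u s * v t"
          using that pos \<open>0 < \<tau>\<close> less_trans[OF mult_pos_pos[OF \<open>0 < a\<close> \<open>0 < \<tau>\<close>] that(2)]
          by (intro mult_strict_mono) auto
        also have "\<dots> \<le> (w ((s + t) / 2))\<^sup>2" using mid that by auto
        finally have "c * \<tau> < w ((s + t) / 2)"
          by (rule power2_less_imp_less) (rule nonneg)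
        also have "\<dots> \<le> w r" using that by (intro mono) auto
        finally show ?thesis .
      qed
      show ?thesis unfolding U_def V_def W_def
      proof (rule emeasure_midpoint_down_set)
        show "{s. 0 \<le> s \<and> a * \<tau> < u s} \<noteq> {}" "{s. 0 \<le> s \<and> b * \<tau> < v s} \<noteq> {}"
          using \<open>a * \<tau> < a\<close> \<open>b * \<tau> < b\<close> by (auto simp: a_def b_def)
      qed (use * in auto)
    qed
    then have "indicator {0<..} \<tau> * U \<tau> + indicator {0<..} \<tau> * V \<tau> \<le> 2 * (indicator {0<..} \<tau> * W \<tau>)" for \<tau>
      by (auto simp: indicator_def)
    then have "(\<integral>\<^sup>+\<tau>. indicator {0<..} \<tau> * U \<tau> + indicator {0<..} \<tau> * V \<tau> \<partial>lborel)
        \<le> (\<integral>\<^sup>+\<tau>. 2 * (indicator {0<..} \<tau> * W \<tau>) \<partial>lborel)"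
      by (rule nn_integral_mono)
    then have uvw: "u1 + v1 \<le> 2 * w1"
      by (simp add: u1_def v1_def w1_def nn_integral_add nn_integral_cmult)
    have "(\<integral>\<^sup>+s. ennreal (u s) \<partial>lborel) = ennreal a * u1"
      unfolding u1_def U_def using pos nonneg zero by (intro nn_integral_layer_cake) auto
    moreover have "(\<integral>\<^sup>+s. ennreal (v s) \<partial>lborel) = ennreal b * v1"
      unfolding v1_def V_def using pos nonneg zero by (intro nn_integral_layer_cake) auto
    ultimately have "4 * ((\<integral>\<^sup>+s. ennreal (u s) \<partial>lborel) * (\<integral>\<^sup>+s. ennreal (v s) \<partial>lborel))
        = 4 * ((ennreal a * u1) * (ennreal b * v1))" by simp
    also have "\<dots> = ennreal (c\<^sup>2) * (4 * (u1 * v1))"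
      using pos by (simp add: c_def ennreal_mult ac_simps)
    also have "\<dots> \<le> ennreal (c\<^sup>2) * (2 * w1)\<^sup>2"
      by (rule mult_left_mono) (use order_trans[OF ennreal_four_mult_le_add_squared power_mono[OF uvw]] in auto)
    also have "\<dots> = 4 * (ennreal c * w1)\<^sup>2"
      using pos by (simp add: power_mult_distrib ennreal_power ac_simps)
    also have "ennreal c * w1 = (\<integral>\<^sup>+s. ennreal (w s) \<partial>lborel)"
      unfolding w1_def W_def using pos nonneg zero by (intro nn_integral_layer_cake[symmetric]) auto
    finally show ?thesis
      by (subst (asm) ennreal_mult_le_mult_iff) auto
  qed
qed

section \<open>Down-monotone densities and their marginals\<close>

interpretation lborel_product: product_sigma_finite "\<lambda>_ :: 'i. lborel :: real measure"
  by standard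

lemma borel_measurable_fun_upd_component:
  assumes "f \<in> borel_measurable (Pi\<^sub>M (insert i J) (\<lambda>_. lborel))" "x \<in> J \<rightarrow>\<^sub>E UNIV"
  shows "(\<lambda>s. f (x(i := s))) \<in> borel_measurable (borel :: real measure)"
proof -
  have "(\<lambda>s. x(i := s)) \<in> lborel \<rightarrow>\<^sub>M Pi\<^sub>M (insert i J) (\<lambda>_. lborel)"
    using assms(2) by (intro measurable_fun_upd[where J = J]) (auto simp: space_PiM)
  from measurable_compose[OF this assms(1)] show ?thesis by simp
qed

section \<open>Rescaling by one half\<close>

lemma nn_integral_lborel_halve:
  fixes \<phi> :: "real \<Rightarrow> ennreal"
  assumes "\<phi> \<in> borel_measurable borel"
  shows "(\<integral>\<^sup>+s. \<phi> (s / 2) \<partial>lborel) = 2 * (\<integral>\<^sup>+s. \<phi> s \<partial>lborel)"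
proof -
  have "2 * (\<integral>\<^sup>+s. \<phi> s \<partial>lborel) = (2 * ennreal (1/2)) * (\<integral>\<^sup>+s. \<phi> (s / 2) \<partial>lborel)"
    using nn_integral_real_affine[OF assms, of "1/2" 0] by (simp add: ac_simps)
  also have "2 * ennreal (1/2) = ennreal (2 * (1/2))"
    by (subst ennreal_mult') auto
  finally show ?thesis by simp
qed

lemma nn_integral_PiM_halve:
  fixes \<phi> :: "('i \<Rightarrow> real) \<Rightarrow> ennreal"
  assumes "finite I" "\<phi> \<in> borel_measurable (Pi\<^sub>M I (\<lambda>_. lborel))"
  shows "(\<integral>\<^sup>+x. \<phi> (\<lambda>i\<in>I. x i / 2) \<partial>Pi\<^sub>M I (\<lambda>_. lborel)) = 2 ^ card I * (\<integral>\<^sup>+x. \<phi> x \<partial>Pi\<^sub>M I (\<lambda>_. lborel))"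
  using assms
proof (induction I arbitrary: \<phi> rule: finite_induct)
  case empty
  then show ?case by (simp add: PiM_empty restrict_def nn_integral_count_space_finite)
next
  case (insert i J)
  note insert.prems[measurable] insert.hyps(1)[simp]
  define \<Phi> where "\<Phi> y = (\<integral>\<^sup>+s. \<phi> (y(i := s)) \<partial>lborel)" for y
  have [measurable]: "\<Phi> \<in> borel_measurable (Pi\<^sub>M J (\<lambda>_. lborel))"
    unfolding \<Phi>_def by measurable
  have "(\<integral>\<^sup>+x. \<phi> (\<lambda>j\<in>insert i J. x j / 2) \<partial>Pi\<^sub>M (insert i J) (\<lambda>_. lborel))
      = (\<integral>\<^sup>+x. \<integral>\<^sup>+s. \<phi> (\<lambda>j\<in>insert i J. (x(i := s)) j / 2) \<partial>lborel \<partial>Pi\<^sub>M J (\<lambda>_. lborel))"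
    using insert.hyps by (subst lborel_product.product_nn_integral_insert) auto
  also have "\<dots> = (\<integral>\<^sup>+x. 2 * \<Phi> (\<lambda>j\<in>J. x j / 2) \<partial>Pi\<^sub>M J (\<lambda>_. lborel))"
  proof (rule nn_integral_cong)
    fix x :: "'i \<Rightarrow> real" assume "x \<in> space (Pi\<^sub>M J (\<lambda>_. lborel))"
    have "(\<lambda>j\<in>insert i J. (x(i := s)) j / 2) = (\<lambda>j\<in>J. x j / 2)(i := s / 2)" for s
      using insert.hyps by (auto simp: fun_eq_iff)
    moreover have "(\<lambda>s. \<phi> ((\<lambda>j\<in>J. x j / 2)(i := s))) \<in> borel_measurable borel"
      using insert.prems by (rule borel_measurable_fun_upd_component) auto
    ultimately show "(\<integral>\<^sup>+s. \<phi> (\<lambda>j\<in>insert i J. (x(i := s)) j / 2) \<partial>lborel) = 2 * \<Phi> (\<lambda>j\<in>J. x j / 2)"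
      unfolding \<Phi>_def by (simp add: nn_integral_lborel_halve[of "\<lambda>s. \<phi> ((\<lambda>j\<in>J. x j / 2)(i := s))"])
  qed
  also have "\<dots> = 2 * (\<integral>\<^sup>+x. \<Phi> (\<lambda>j\<in>J. x j / 2) \<partial>Pi\<^sub>M J (\<lambda>_. lborel))"
    by (rule nn_integral_cmult) measurable
  also have "\<dots> = 2 ^ card (insert i J) * (\<integral>\<^sup>+x. \<Phi> x \<partial>Pi\<^sub>M J (\<lambda>_. lborel))"
    using insert.hyps by (subst insert.IH) (auto simp: ac_simps)
  also have "(\<integral>\<^sup>+x. \<Phi> x \<partial>Pi\<^sub>M J (\<lambda>_. lborel)) = (\<integral>\<^sup>+x. \<phi> x \<partial>Pi\<^sub>M (insert i J) (\<lambda>_. lborel))"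
    unfolding \<Phi>_def using insert.hyps by (subst lborel_product.product_nn_integral_insert) auto
  finally show ?case .
qed

section \<open>Densities on the orthant with monotonicity and the midpoint inequality\<close>

lemma orthant_iff: "x \<in> orthant I \<longleftrightarrow> x \<in> I \<rightarrow>\<^sub>E UNIV \<and> (\<forall>i\<in>I. 0 \<le> x i)"
  by (auto simp: orthant_def PiE_iff)

text \<open>The conditions are chosen to be closed under integrating out a coordinate.
  \<open>midpoint\<close> is logconcavity at weight 1/2, squared; \<open>total\<close> uses the
  nonnegative integral, so that no integrability has to be carried along.\<close>

locale dm_density =
  fixes I :: "'i set" and f :: "('i \<Rightarrow> real) \<Rightarrow> real"
  assumes finite_index: "finite I"
    and borel_measurable_density: "f \<in> borel_measurable (Pi\<^sub>M I (\<lambda>_. lborel))"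
    and nonneg: "x \<in> I \<rightarrow>\<^sub>E UNIV \<Longrightarrow> 0 \<le> f x"
    and off_orthant: "x \<in> I \<rightarrow>\<^sub>E UNIV \<Longrightarrow> x \<notin> orthant I \<Longrightarrow> f x = 0"
    and antimono: "x \<in> orthant I \<Longrightarrow> y \<in> orthant I \<Longrightarrow> (\<And>i. i \<in> I \<Longrightarrow> x i \<le> y i) \<Longrightarrow> f y \<le> f x"
    and midpoint: "x \<in> orthant I \<Longrightarrow> y \<in> orthant I \<Longrightarrow> f x * f y \<le> (f (\<lambda>i\<in>I. (x i + y i) / 2))\<^sup>2"
    and total: "(\<integral>\<^sup>+x. ennreal (f x) \<partial>Pi\<^sub>M I (\<lambda>_. lborel)) = 1"
begin

declare borel_measurable_density[measurable]

abbreviation origin :: "'i \<Rightarrow> real" where "origin \<equiv> \<lambda>i\<in>I. 0"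

lemma origin_in_orthant: "origin \<in> orthant I"
  by (simp add: orthant_iff)

lemma le_origin: "x \<in> I \<rightarrow>\<^sub>E UNIV \<Longrightarrow> f x \<le> f origin"
  using off_orthant[of x] nonneg[of origin] antimono[OF origin_in_orthant, of x]
  by (cases "x \<in> orthant I") (auto simp: orthant_iff)

lemma origin_pos: "0 < f origin"
proof (rule ccontr)
  assume "\<not> 0 < f origin"
  then have *: "f origin \<le> 0" by simp
  have "(\<integral>\<^sup>+x. ennreal (f x) \<partial>Pi\<^sub>M I (\<lambda>_. lborel)) = (\<integral>\<^sup>+(x :: 'i \<Rightarrow> real). 0 \<partial>Pi\<^sub>M I (\<lambda>_. lborel))"
    using order_trans[OF le_origin *] by (intro nn_integral_cong) (auto simp: space_PiM ennreal_eq_0_iff)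
  then show False using total by simp
qed

lemma mult_origin_le: "x \<in> I \<rightarrow>\<^sub>E UNIV \<Longrightarrow> f x * f origin \<le> (f (\<lambda>i\<in>I. x i / 2))\<^sup>2"
proof (cases "x \<in> orthant I")
  case True
  from midpoint[OF this origin_in_orthant]
  show ?thesis by (simp cong: restrict_cong)
next
  case False
  assume "x \<in> I \<rightarrow>\<^sub>E UNIV"
  from off_orthant[OF this False] show ?thesis by simp
qed

lemma nn_integral_sqrt_le:
  "(\<integral>\<^sup>+x. ennreal (sqrt (f x * f origin)) \<partial>Pi\<^sub>M I (\<lambda>_. lborel)) \<le> 2 ^ card I"
proof -
  have "(\<integral>\<^sup>+x. ennreal (sqrt (f x * f origin)) \<partial>Pi\<^sub>M I (\<lambda>_. lborel))
      \<le> (\<integral>\<^sup>+x. ennreal (f (\<lambda>i\<in>I. x i / 2)) \<partial>Pi\<^sub>M I (\<lambda>_. lborel))"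
  proof (intro nn_integral_mono ennreal_leI)
    fix x assume "x \<in> space (Pi\<^sub>M I (\<lambda>_. lborel :: real measure))"
    then have "x \<in> I \<rightarrow>\<^sub>E UNIV" by (simp add: space_PiM)
    then show "sqrt (f x * f origin) \<le> f (\<lambda>i\<in>I. x i / 2)"
      using mult_origin_le[of x] nonneg[of "\<lambda>i\<in>I. x i / 2"] by (intro real_le_lsqrt) auto
  qed
  also have "\<dots> = 2 ^ card I"
    using finite_index total by (subst nn_integral_PiM_halve[where \<phi> = "\<lambda>x. ennreal (f x)"]) auto
  finally show ?thesis .
qed

text \<open>On the box below \<open>x\<close> the density is at least \<open>f x\<close>, the volume
  of the box is the product of the coordinates, and its mass is at most 1.\<close>

lemma mult_prod_le_1:
  assumes x: "x \<in> orthant I"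
  shows "f x * (\<Prod>i\<in>I. x i) \<le> 1"
proof -
  have x': "x \<in> I \<rightarrow>\<^sub>E UNIV" "\<And>i. i \<in> I \<Longrightarrow> 0 \<le> x i" using x by (auto simp: orthant_iff)
  have box: "Pi\<^sub>E I (\<lambda>i. {0..x i}) \<in> sets (Pi\<^sub>M I (\<lambda>_. lborel))"
    using finite_index by (intro sets_PiM_I_finite) auto
  have "ennreal (f x) * emeasure (Pi\<^sub>M I (\<lambda>_. lborel)) (Pi\<^sub>E I (\<lambda>i. {0..x i}))
      = (\<integral>\<^sup>+y. ennreal (f x) * indicator (Pi\<^sub>E I (\<lambda>i. {0..x i})) y \<partial>Pi\<^sub>M I (\<lambda>_. lborel))"
    using box by (simp add: nn_integral_cmult_indicator)
  also have "\<dots> \<le> (\<integral>\<^sup>+y. ennreal (f y) \<partial>Pi\<^sub>M I (\<lambda>_. lborel))"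
  proof (intro nn_integral_mono)
    fix y
    have "f x \<le> f y" if "y \<in> Pi\<^sub>E I (\<lambda>i. {0..x i})"
      using that by (intro antimono x) (auto simp: orthant_iff PiE_iff)
    then show "ennreal (f x) * indicator (Pi\<^sub>E I (\<lambda>i. {0..x i})) y \<le> ennreal (f y)"
      by (auto simp: indicator_def intro: ennreal_leI)
  qed
  also have "\<dots> = 1" by (rule total)
  also have "emeasure (Pi\<^sub>M I (\<lambda>_. lborel)) (Pi\<^sub>E I (\<lambda>i. {0..x i})) = ennreal (\<Prod>i\<in>I. x i)"
    using finite_index x' by (subst lborel_product.emeasure_PiM) (auto simp: prod_ennreal)
  finally have "ennreal (f x * (\<Prod>i\<in>I. x i)) \<le> ennreal 1"
    using x' nonneg[OF x'(1)] by (subst ennreal_mult) (auto intro: prod_nonneg)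
  then show ?thesis by (subst (asm) ennreal_le_iff) auto
qed

end

text \<open>The slices in direction \<open>i\<close> over x, y and their midpoint satisfy the
  hypotheses of \<open>prekopa_leindler_decreasing\<close>, so the fibre integral \<open>G\<close>
  inherits the midpoint inequality. \<open>G\<close> takes values in \<open>ennreal\<close>, and its
  finiteness has to be shown before it can be turned into a real density. The marginal is described
  through test functions \<open>\<phi>\<close> because this form composes when several coordinates
  are removed.\<close>

lemma dm_density_marginal_insert:
  assumes "dm_density (insert i J) f" and i: "i \<notin> J"
  obtains g where "dm_density J g"
    "\<And>\<phi>. \<phi> \<in> borel_measurable (Pi\<^sub>M J (\<lambda>_. lborel)) \<Longrightarrow>
       (\<integral>\<^sup>+x. ennreal (f x) * \<phi> (restrict x J) \<partial>Pi\<^sub>M (insert i J) (\<lambda>_. lborel)) =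
       (\<integral>\<^sup>+x. ennreal (g x) * \<phi> x \<partial>Pi\<^sub>M J (\<lambda>_. lborel))"
proof -
  interpret dm_density "insert i J" f by fact
  have fin[simp]: "finite J" using finite_index by simp
  define G where "G x = (\<integral>\<^sup>+s. ennreal (f (x(i := s))) \<partial>lborel)" for x
  have [measurable]: "G \<in> borel_measurable (Pi\<^sub>M J (\<lambda>_. lborel))"
    unfolding G_def by measurable
  have upd: "x(i := s) \<in> insert i J \<rightarrow>\<^sub>E UNIV" if "x \<in> J \<rightarrow>\<^sub>E UNIV" for x :: "'a \<Rightarrow> real" and s
    using that by (auto simp: PiE_iff extensional_def)
  have orth: "x(i := s) \<in> orthant (insert i J) \<longleftrightarrow> x \<in> orthant J \<and> 0 \<le> s"
    if "x \<in> J \<rightarrow>\<^sub>E UNIV" for x :: "'a \<Rightarrow> real" and s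
    using that upd[OF that] i by (auto simp: orthant_iff)
  have [measurable]: "(\<lambda>s. f (x(i := s))) \<in> borel_measurable borel" if "x \<in> J \<rightarrow>\<^sub>E UNIV" for x
    using that by (rule borel_measurable_fun_upd_component[OF borel_measurable_density])
  have G_mid: "G x * G y \<le> (G (\<lambda>j\<in>J. (x j + y j) / 2))\<^sup>2" if x: "x \<in> orthant J" and y: "y \<in> orthant J" for x y
  proof -
    define z where "z = (\<lambda>j\<in>J. (x j + y j) / 2)"
    have z: "z \<in> orthant J" using x y by (auto simp: z_def orthant_iff)
    have xyz: "x \<in> J \<rightarrow>\<^sub>E UNIV" "y \<in> J \<rightarrow>\<^sub>E UNIV" "z \<in> J \<rightarrow>\<^sub>E UNIV"
      using x y z by (auto simp: orthant_iff)
    have anti: "f (a(i := t)) \<le> f (a(i := s))" if "a \<in> orthant J" "0 \<le> s" "s \<le> t" for a s t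
      using that by (intro antimono) (auto simp: orth orthant_iff[of a])
    have neg: "f (a(i := s)) = 0" if "a \<in> orthant J" "s < 0" for a s
      using that upd[of a s] by (intro off_orthant) (auto simp: orth orthant_iff[of a])
    have mid: "f (x(i := s)) * f (y(i := t)) \<le> (f (z(i := (s + t) / 2)))\<^sup>2" if "0 \<le> s" "0 \<le> t" for s t
    proof -
      have "(\<lambda>j\<in>insert i J. ((x(i := s)) j + (y(i := t)) j) / 2) = z(i := (s + t) / 2)"
        using i by (auto simp: z_def fun_eq_iff)
      with midpoint[of "x(i := s)" "y(i := t)"] show ?thesis
        using that x y xyz by (simp add: orth)
    qed
    have "(\<integral>\<^sup>+s. ennreal (f (x(i := s))) \<partial>lborel) * (\<integral>\<^sup>+s. ennreal (f (y(i := s))) \<partial>lborel)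
      \<le> (\<integral>\<^sup>+s. ennreal (f (z(i := s))) \<partial>lborel)\<^sup>2"
      using xyz
      by (intro prekopa_leindler_decreasing mid)
        (auto intro!: nonneg upd intro: anti neg x y z)
    then show ?thesis by (simp add: G_def z_def)
  qed
  have G_anti: "G y \<le> G x" if "x \<in> orthant J" "y \<in> orthant J" "\<And>j. j \<in> J \<Longrightarrow> x j \<le> y j" for x y
    unfolding G_def
  proof (intro nn_integral_mono ennreal_leI)
    fix s
    have xy: "x \<in> J \<rightarrow>\<^sub>E UNIV" "y \<in> J \<rightarrow>\<^sub>E UNIV" using that by (auto simp: orthant_iff)
    show "f (y(i := s)) \<le> f (x(i := s))"
    proof (cases "0 \<le> s")
      case True
      with that i show ?thesis by (intro antimono) (auto simp: orth xy)
    next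
      case False
      then have "f (y(i := s)) = 0" "f (x(i := s)) = 0" using upd xy orth by (auto intro!: off_orthant)
      then show ?thesis by simp
    qed
  qed
  have G_off: "G x = 0" if "x \<in> J \<rightarrow>\<^sub>E UNIV" "x \<notin> orthant J" for x
  proof -
    have "f (x(i := s)) = 0" for s using that upd orth by (auto intro!: off_orthant)
    then show ?thesis by (simp add: G_def)
  qed
  have G_total: "(\<integral>\<^sup>+x. G x \<partial>Pi\<^sub>M J (\<lambda>_. lborel)) = 1"
    using total i unfolding G_def by (subst (asm) lborel_product.product_nn_integral_insert) auto
  define o' :: "'a \<Rightarrow> real" where "o' = (\<lambda>j\<in>J. 0)"
  have o': "o' \<in> orthant J" by (auto simp: o'_def orthant_iff)
  \<comment> \<open>An infinite value at the origin would, by the midpoint inequality, make \<open>G(x/2)\<close> infinite wherever \<open>G(x) > 0\<close>.\<close>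
  have G0: "G o' \<noteq> \<infinity>"
  proof
    assume inf: "G o' = \<infinity>"
    have "(\<integral>\<^sup>+x. G (\<lambda>j\<in>J. x j / 2) \<partial>Pi\<^sub>M J (\<lambda>_. lborel)) = 2 ^ card J"
      using G_total by (subst nn_integral_PiM_halve) auto
    then have "AE x in Pi\<^sub>M J (\<lambda>_. lborel). G (\<lambda>j\<in>J. x j / 2) \<noteq> \<infinity>"
      by (intro nn_integral_PInf_AE) (auto simp: power_eq_top_ennreal)
    then have "AE x in Pi\<^sub>M J (\<lambda>_. lborel). G x = 0"
      using AE_space
    proof eventually_elim
      fix x assume x: "x \<in> space (Pi\<^sub>M J (\<lambda>_. lborel :: real measure))" then have x: "x \<in> J \<rightarrow>\<^sub>E UNIV" by (simp add: space_PiM)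
      assume fin: "G (\<lambda>j\<in>J. x j / 2) \<noteq> \<infinity>"
      have "G x * G o' \<le> (G (\<lambda>j\<in>J. x j / 2))\<^sup>2" if "x \<in> orthant J"
      proof -
        have "(\<lambda>j\<in>J. (x j + o' j) / 2) = (\<lambda>j\<in>J. x j / 2)" by (simp add: o'_def fun_eq_iff)
        then show ?thesis using G_mid[OF that o'] by simp
      qed
      then show "G x = 0"
        using fin inf G_off[of x] x by (cases "x \<in> orthant J")
          (auto simp: ennreal_mult_top power_eq_top_ennreal top_unique split: if_splits)
    qed
    then have "(\<integral>\<^sup>+x. G x \<partial>Pi\<^sub>M J (\<lambda>_. lborel)) = 0"
      by (subst nn_integral_0_iff_AE) auto
    with G_total show False by simp
  qed
  \<comment> \<open>Domination by the value at the origin makes \<open>G\<close> finite on the whole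
    product space, so the conversion by \<open>enn2real\<close> loses nothing.\<close>
  have G_le: "G x \<le> G o'" if "x \<in> J \<rightarrow>\<^sub>E UNIV" for x
    using G_off[OF that] G_anti[OF o', of x] by (cases "x \<in> orthant J") (auto simp: o'_def orthant_iff)
  define g where "g x = enn2real (G x)" for x
  have g: "ennreal (g x) = G x" if "x \<in> J \<rightarrow>\<^sub>E UNIV" for x
    using G_le[OF that] G0 by (simp add: g_def less_top top_unique)
  have g_space: "(\<integral>\<^sup>+x. ennreal (g x) * \<phi> x \<partial>Pi\<^sub>M J (\<lambda>_. lborel)) = (\<integral>\<^sup>+x. G x * \<phi> x \<partial>Pi\<^sub>M J (\<lambda>_. lborel))" for \<phi>
    by (intro nn_integral_cong) (simp add: g space_PiM)
  have "dm_density J g"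
  proof
    show "g \<in> borel_measurable (Pi\<^sub>M J (\<lambda>_. lborel))" unfolding g_def by measurable
    show g_nonneg: "0 \<le> g x" for x by (simp add: g_def)
    show "g x = 0" if "x \<in> J \<rightarrow>\<^sub>E UNIV" "x \<notin> orthant J" for x using G_off[OF that] by (simp add: g_def)
    show "g y \<le> g x" if "x \<in> orthant J" "y \<in> orthant J" "\<And>j. j \<in> J \<Longrightarrow> x j \<le> y j" for x y
    proof -
      have "ennreal (g y) \<le> ennreal (g x)"
        using G_anti[OF that] that by (simp add: g orthant_iff)
      then show ?thesis by (simp add: ennreal_le_iff g_def)
    qed
    show "g x * g y \<le> (g (\<lambda>j\<in>J. (x j + y j) / 2))\<^sup>2" if "x \<in> orthant J" "y \<in> orthant J" for x y
    proof -
      have "ennreal (g x * g y) \<le> ennreal ((g (\<lambda>j\<in>J. (x j + y j) / 2))\<^sup>2)"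
        using G_mid[OF that] that g_nonneg
        by (simp add: g orthant_iff ennreal_mult' flip: ennreal_power)
      then show ?thesis by (simp add: ennreal_le_iff)
    qed
    show "(\<integral>\<^sup>+x. ennreal (g x) \<partial>Pi\<^sub>M J (\<lambda>_. lborel)) = 1"
      using g_space[of "\<lambda>_. 1"] G_total by simp
  qed simp
  moreover have "(\<integral>\<^sup>+x. ennreal (f x) * \<phi> (restrict x J) \<partial>Pi\<^sub>M (insert i J) (\<lambda>_. lborel)) =
       (\<integral>\<^sup>+x. ennreal (g x) * \<phi> x \<partial>Pi\<^sub>M J (\<lambda>_. lborel))"
    if [measurable]: "\<phi> \<in> borel_measurable (Pi\<^sub>M J (\<lambda>_. lborel))" for \<phi>
  proof -
    have [measurable]: "(\<lambda>x. restrict x J) \<in> Pi\<^sub>M (insert i J) (\<lambda>_. lborel) \<rightarrow>\<^sub>M Pi\<^sub>M J (\<lambda>_. lborel :: real measure)"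
      by (rule measurable_restrict_subset) auto
    have "(\<integral>\<^sup>+x. ennreal (f x) * \<phi> (restrict x J) \<partial>Pi\<^sub>M (insert i J) (\<lambda>_. lborel)) =
      (\<integral>\<^sup>+x. (\<integral>\<^sup>+s. ennreal (f (x(i := s))) * \<phi> (restrict (x(i := s)) J) \<partial>lborel) \<partial>Pi\<^sub>M J (\<lambda>_. lborel))"
      using i by (subst lborel_product.product_nn_integral_insert) auto
    also have "\<dots> = (\<integral>\<^sup>+x. G x * \<phi> x \<partial>Pi\<^sub>M J (\<lambda>_. lborel))"
    proof (rule nn_integral_cong)
      fix x assume "x \<in> space (Pi\<^sub>M J (\<lambda>_. lborel :: real measure))"
      then have x: "x \<in> J \<rightarrow>\<^sub>E UNIV" by (simp add: space_PiM)
      then have "restrict (x(i := s)) J = x" for s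
        using i by (auto simp: fun_eq_iff PiE_iff extensional_def)
      then show "(\<integral>\<^sup>+s. ennreal (f (x(i := s))) * \<phi> (restrict (x(i := s)) J) \<partial>lborel) = G x * \<phi> x"
        using x by (simp add: G_def nn_integral_multc)
    qed
    finally show ?thesis by (simp add: g_space)
  qed
  ultimately show ?thesis by (rule that)
qed

text \<open>The coordinates outside \<open>J\<close> are integrated out one at a time; the formulas
  for test functions compose because restricting in two steps is restricting once.\<close>

lemma dm_density_marginal:
  assumes "dm_density I f" "J \<subseteq> I"
  obtains g where "dm_density J g"
    "\<And>\<phi>. \<phi> \<in> borel_measurable (Pi\<^sub>M J (\<lambda>_. lborel)) \<Longrightarrow>
       (\<integral>\<^sup>+x. ennreal (f x) * \<phi> (restrict x J) \<partial>Pi\<^sub>M I (\<lambda>_. lborel)) =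
       (\<integral>\<^sup>+x. ennreal (g x) * \<phi> x \<partial>Pi\<^sub>M J (\<lambda>_. lborel))"
proof -
  have "\<exists>g. dm_density J g \<and> (\<forall>\<phi> \<in> borel_measurable (Pi\<^sub>M J (\<lambda>_. lborel)).
       (\<integral>\<^sup>+x. ennreal (f x) * \<phi> (restrict x J) \<partial>Pi\<^sub>M (J \<union> D) (\<lambda>_. lborel)) =
       (\<integral>\<^sup>+x. ennreal (g x) * \<phi> x \<partial>Pi\<^sub>M J (\<lambda>_. lborel)))"
    if "finite D" "J \<inter> D = {}" "dm_density (J \<union> D) f" for D f
    using that
  proof (induction D arbitrary: f rule: finite_induct)
    case empty
    have "(\<integral>\<^sup>+x. ennreal (f x) * \<phi> (restrict x J) \<partial>Pi\<^sub>M J (\<lambda>_. lborel)) =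
       (\<integral>\<^sup>+x. ennreal (f x) * \<phi> x \<partial>Pi\<^sub>M J (\<lambda>_. lborel))" for \<phi> :: "_ \<Rightarrow> ennreal"
      by (intro nn_integral_cong) (auto simp: space_PiM PiE_restrict)
    with empty.prems show ?case unfolding Un_empty_right by blast
  next
    case (insert i D)
    then obtain h where h: "dm_density (J \<union> D) h"
      "\<And>\<phi>. \<phi> \<in> borel_measurable (Pi\<^sub>M (J \<union> D) (\<lambda>_. lborel)) \<Longrightarrow>
       (\<integral>\<^sup>+x. ennreal (f x) * \<phi> (restrict x (J \<union> D)) \<partial>Pi\<^sub>M (insert i (J \<union> D)) (\<lambda>_. lborel)) =
       (\<integral>\<^sup>+x. ennreal (h x) * \<phi> x \<partial>Pi\<^sub>M (J \<union> D) (\<lambda>_. lborel))"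
      using dm_density_marginal_insert[of i "J \<union> D" f] by auto
    obtain g where g: "dm_density J g" "\<And>\<phi>. \<phi> \<in> borel_measurable (Pi\<^sub>M J (\<lambda>_. lborel)) \<Longrightarrow>
       (\<integral>\<^sup>+x. ennreal (h x) * \<phi> (restrict x J) \<partial>Pi\<^sub>M (J \<union> D) (\<lambda>_. lborel)) =
       (\<integral>\<^sup>+x. ennreal (g x) * \<phi> x \<partial>Pi\<^sub>M J (\<lambda>_. lborel))"
      using insert.IH[OF _ h(1)] insert.prems(1) by blast
    have "(\<integral>\<^sup>+x. ennreal (f x) * \<phi> (restrict x J) \<partial>Pi\<^sub>M (J \<union> insert i D) (\<lambda>_. lborel)) =
       (\<integral>\<^sup>+x. ennreal (g x) * \<phi> x \<partial>Pi\<^sub>M J (\<lambda>_. lborel))"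
      if \<phi>: "\<phi> \<in> borel_measurable (Pi\<^sub>M J (\<lambda>_. lborel))" for \<phi>
    proof -
      have "(\<lambda>x. \<phi> (restrict x J)) \<in> borel_measurable (Pi\<^sub>M (J \<union> D) (\<lambda>_. lborel))"
        by (rule measurable_compose[OF measurable_restrict_subset \<phi>]) auto
      from h(2)[OF this] g(2)[OF \<phi>] show ?thesis by (simp add: Int_absorb1 restrict_restrict)
    qed
    with g(1) show ?case by blast
  qed
  from this[of "I - J" f] assms that show ?thesis
    by (auto simp: Un_absorb1 Un_Diff_cancel dest: dm_density.finite_index)
qed

section \<open>Moments and the density at the origin\<close>

lemma sqrt_prod: "sqrt (\<Prod>i\<in>I. g i) = (\<Prod>i\<in>I. sqrt (g i))"
  by (induction I rule: infinite_finite_induct) (auto simp: real_sqrt_mult)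

text \<open>One-coordinate marginals, as functions of a real number instead of a function on a
  singleton. \<open>halving\<close> is the midpoint inequality with one endpoint at 0.\<close>

locale real_dm_density =
  fixes u :: "real \<Rightarrow> real"
  assumes borel_measurable_density: "u \<in> borel_measurable borel"
    and nonneg: "0 \<le> u s"
    and neg: "s < 0 \<Longrightarrow> u s = 0"
    and antimono: "0 \<le> s \<Longrightarrow> s \<le> t \<Longrightarrow> u t \<le> u s"
    and halving: "u s * u 0 \<le> (u (s / 2))\<^sup>2"
    and total: "(\<integral>\<^sup>+s. ennreal (u s) \<partial>lborel) = 1"
begin

declare borel_measurable_density[measurable]

lemma le_at_0: "u s \<le> u 0"
  using antimono[of 0 s] neg[of s] nonneg[of 0] by (cases "s < 0") auto

lemma at_0_pos: "0 < u 0"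
proof (rule ccontr)
  assume "\<not> 0 < u 0"
  then have "u s = 0" for s using le_at_0[of s] nonneg[of s] by linarith
  then show False using total by simp
qed

text \<open>For r = u / u(0), \<open>halving\<close> says that the root of r(s) is at most r(s/2).
  Used once and twice, it bounds the integrals of r^(1/2) and r^(1/4) by 2/u(0) and 4/u(0). As
  r^(1/4) decreases, s r(s)^(1/4) \<le> 4/u(0). In the splitting r = (r^(1/4))^2 r^(1/2) the first
  factor absorbs s^2 and the second is integrated, whence 32 = 4^2 * 2.\<close>

lemma nn_integral_second_moment_le:
  "(\<integral>\<^sup>+s. ennreal (u s * s\<^sup>2) \<partial>lborel) \<le> ennreal (32 / (u 0)\<^sup>2)"
proof -
  define r where "r s = u s / u 0" for s
  have [measurable]: "r \<in> borel_measurable borel" unfolding r_def by measurable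
  have r0: "0 \<le> r s" for s using at_0_pos nonneg by (simp add: r_def)
  have "r s \<le> (r (s / 2))\<^sup>2" for s
    using halving[of s] at_0_pos by (simp add: r_def power_divide) (simp add: field_simps power2_eq_square)
  then have r_half: "sqrt (r s) \<le> r (s / 2)" for s
    using r0 by (intro real_le_lsqrt) auto
  have "(\<integral>\<^sup>+s. ennreal (r s) \<partial>lborel) = (\<integral>\<^sup>+s. ennreal (1 / u 0) * ennreal (u s) \<partial>lborel)"
    using at_0_pos nonneg by (intro nn_integral_cong) (simp add: r_def flip: ennreal_mult)
  also have "\<dots> = ennreal (1 / u 0)" by (simp add: nn_integral_cmult total)
  finally have I0: "(\<integral>\<^sup>+s. ennreal (r s) \<partial>lborel) = ennreal (1 / u 0)" .
  have "(\<integral>\<^sup>+s. ennreal (sqrt (r s)) \<partial>lborel) \<le> (\<integral>\<^sup>+s. ennreal (r (s / 2)) \<partial>lborel)"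
    by (intro nn_integral_mono ennreal_leI r_half)
  also have "\<dots> = 2 * ennreal (1 / u 0)"
    by (subst nn_integral_lborel_halve[of "\<lambda>s. ennreal (r s)"]) (auto simp: I0)
  finally have I1: "(\<integral>\<^sup>+s. ennreal (sqrt (r s)) \<partial>lborel) \<le> ennreal (2 / u 0)"
    using ennreal_mult'[of 2 "1 / u 0"] by simp
  have "(\<integral>\<^sup>+s. ennreal (sqrt (sqrt (r s))) \<partial>lborel) \<le> (\<integral>\<^sup>+s. ennreal (sqrt (r (s / 2))) \<partial>lborel)"
    by (intro nn_integral_mono ennreal_leI real_sqrt_le_mono r_half)
  also have "\<dots> = 2 * (\<integral>\<^sup>+s. ennreal (sqrt (r s)) \<partial>lborel)"
    by (subst nn_integral_lborel_halve[of "\<lambda>s. ennreal (sqrt (r s))"]) auto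
  also have "\<dots> \<le> 2 * ennreal (2 / u 0)" by (intro mult_left_mono I1) auto
  finally have I2: "(\<integral>\<^sup>+s. ennreal (sqrt (sqrt (r s))) \<partial>lborel) \<le> ennreal (4 / u 0)"
    using ennreal_mult'[of 2 "2 / u 0"] by simp
  have tail: "s * sqrt (sqrt (r s)) \<le> 4 / u 0" if "0 \<le> s" for s
  proof -
    have "ennreal (s * sqrt (sqrt (r s))) = (\<integral>\<^sup>+t. ennreal (sqrt (sqrt (r s))) * indicator {0..s} t \<partial>lborel)"
      using that r0 by (subst nn_integral_cmult_indicator) (auto simp: ennreal_mult ac_simps)
    also have "\<dots> \<le> (\<integral>\<^sup>+t. ennreal (sqrt (sqrt (r t))) \<partial>lborel)"
      using at_0_pos
      by (intro nn_integral_mono)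
        (auto simp: indicator_def r_def divide_right_mono antimono intro!: ennreal_leI)
    also note I2
    finally show ?thesis using at_0_pos by simp
  qed
  have "(\<integral>\<^sup>+s. ennreal (u s * s\<^sup>2) \<partial>lborel) \<le> (\<integral>\<^sup>+s. ennreal (16 / u 0) * ennreal (sqrt (r s)) \<partial>lborel)"
  proof (rule nn_integral_mono)
    fix s
    have "u s * s\<^sup>2 \<le> (16 / u 0) * sqrt (r s)"
    proof (cases "0 \<le> s")
      case True
      have "sqrt (sqrt (r s)) ^ 2 = sqrt (r s)" using r0[of s] by simp
      then have "u s * s\<^sup>2 = u 0 * (s * sqrt (sqrt (r s)))\<^sup>2 * sqrt (r s)"
        using at_0_pos nonneg[of s] by (simp add: r_def power_mult_distrib)
      also have "\<dots> \<le> u 0 * (4 / u 0)\<^sup>2 * sqrt (r s)"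
        using at_0_pos r0[of s] True
        by (intro mult_right_mono mult_left_mono power_mono tail) auto
      also have "\<dots> = (16 / u 0) * sqrt (r s)"
        using at_0_pos by (simp add: power2_eq_square)
      finally show ?thesis .
    qed (use neg[of s] at_0_pos r0[of s] in auto)
    then show "ennreal (u s * s\<^sup>2) \<le> ennreal (16 / u 0) * ennreal (sqrt (r s))"
      using at_0_pos r0[of s] by (simp add: ennreal_leI flip: ennreal_mult)
  qed
  also have "\<dots> = ennreal (16 / u 0) * (\<integral>\<^sup>+s. ennreal (sqrt (r s)) \<partial>lborel)"
    by (simp add: nn_integral_cmult)
  also have "\<dots> \<le> ennreal (16 / u 0) * ennreal (2 / u 0)"
    by (intro mult_left_mono I1) auto
  also have "\<dots> = ennreal (32 / (u 0)\<^sup>2)"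
    using at_0_pos by (simp add: power2_eq_square flip: ennreal_mult)
  finally show ?thesis .
qed

text \<open>The value \<open>c\<close> on the null set \<open>s \<le> 0\<close> is arbitrary; below it is chosen so large that the pointwise
  tangent estimate for the product of the \<open>\<surd>(x\<^sub>i/\<sigma>\<^sub>i)\<close> also holds on the boundary of the orthant.\<close>
lemma nn_integral_inverse_sqrt_le:
  assumes \<sigma>: "0 < \<sigma>" "\<sigma> * u 0 \<le> 6"
  shows "(\<integral>\<^sup>+s. ennreal (u s * (if s \<le> 0 then c else sqrt (\<sigma> / s))) \<partial>lborel) \<le> 13"
proof -
  define v where "v s = s powr (-1/2)" for s :: real
  have v: "(\<integral>\<^sup>+s. ennreal (v s) * indicator {0..\<sigma>} s \<partial>lborel) = ennreal (2 * sqrt \<sigma>)"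
    using has_integral_powr_from_0[of "-1/2" \<sigma>] \<sigma>
    by (subst nn_integral_has_integral_lebesgue'[where I = "2 * sqrt \<sigma>"]) (auto simp: v_def[abs_def] powr_half_sqrt ac_simps)
  have [measurable]: "v \<in> borel_measurable borel" unfolding v_def by measurable
  have "(\<integral>\<^sup>+s. ennreal (u s * (if s \<le> 0 then c else sqrt (\<sigma> / s))) \<partial>lborel)
      \<le> (\<integral>\<^sup>+s. ennreal (u s) + ennreal (u 0 * sqrt \<sigma>) * (ennreal (v s) * indicator {0..\<sigma>} s) \<partial>lborel)"
  proof (intro nn_integral_mono_AE, rule AE_mp[OF AE_lborel_singleton[of 0]], intro AE_I2 impI)
    \<comment> \<open>Beyond \<sigma> the weight is at most 1, which contributes at most the total
      mass 1. Below \<sigma> the density is at most \<open>u 0\<close> and the weight integrates to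
      2\<sigma>, which contributes at most 12 because \<sigma> u(0) \<le> 6.\<close>
    fix s :: real assume "s \<noteq> 0"
    then consider "s < 0" | "0 < s" "s \<le> \<sigma>" | "0 < s" "\<sigma> < s" by linarith
    then show "ennreal (u s * (if s \<le> 0 then c else sqrt (\<sigma> / s)))
        \<le> ennreal (u s) + ennreal (u 0 * sqrt \<sigma>) * (ennreal (v s) * indicator {0..\<sigma>} s)"
    proof cases
      case 1
      then show ?thesis by (simp add: neg)
    next
      case 2
      have "u s * sqrt (\<sigma> / s) \<le> u 0 * sqrt (\<sigma> / s)"
        using 2 \<sigma> by (intro mult_right_mono le_at_0) auto
      also have "\<dots> = (u 0 * sqrt \<sigma>) * v s"
        using 2 by (simp add: v_def powr_minus_divide powr_half_sqrt real_sqrt_divide)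
      finally have "ennreal (u s * sqrt (\<sigma> / s)) \<le> ennreal (u 0 * sqrt \<sigma>) * ennreal (v s)"
        using nonneg[of 0] \<sigma> by (simp add: ennreal_leI v_def flip: ennreal_mult)
      then show ?thesis using 2 by (auto intro: add_increasing)
    next
      case 3
      then have "u s * sqrt (\<sigma> / s) \<le> u s * 1"
        using \<sigma> nonneg by (intro mult_left_mono) auto
      then show ?thesis using 3 by (simp add: ennreal_leI)
    qed
  qed
  also have "\<dots> = 1 + ennreal (u 0 * sqrt \<sigma>) * ennreal (2 * sqrt \<sigma>)"
    by (simp add: nn_integral_add nn_integral_cmult total v)
  also have "\<dots> = 1 + ennreal (2 * (\<sigma> * u 0))"
    using nonneg[of 0] \<sigma> by (subst ennreal_mult[symmetric]) (auto simp: ac_simps)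
  also have "\<dots> \<le> 1 + ennreal 12"
    using \<sigma> by (intro add_left_mono ennreal_leI) auto
  also have "\<dots> = 13"
    using ennreal_plus[of 1 12] by simp
  finally show ?thesis .
qed

end

section \<open>Root mean squares of the coordinates and the upper bound at the origin\<close>

context dm_density
begin

lemma coordinate_marginal:
  assumes i: "i \<in> I"
  obtains u where "real_dm_density u"
    "\<And>\<phi>. \<phi> \<in> borel_measurable borel \<Longrightarrow>
       (\<integral>\<^sup>+x. ennreal (f x) * \<phi> (x i) \<partial>Pi\<^sub>M I (\<lambda>_. lborel)) = (\<integral>\<^sup>+s. ennreal (u s) * \<phi> s \<partial>lborel)"
proof -
  obtain g where "dm_density {i} g" and g: "\<And>\<phi>. \<phi> \<in> borel_measurable (Pi\<^sub>M {i} (\<lambda>_. lborel)) \<Longrightarrow>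
       (\<integral>\<^sup>+x. ennreal (f x) * \<phi> (restrict x {i}) \<partial>Pi\<^sub>M I (\<lambda>_. lborel)) =
       (\<integral>\<^sup>+x. ennreal (g x) * \<phi> x \<partial>Pi\<^sub>M {i} (\<lambda>_. lborel))"
    using dm_density_marginal[of I f "{i}"] dm_density_axioms i by auto
  interpret g: dm_density "{i}" g by fact
  define e where "e s = (\<lambda>j\<in>{i}. s)" for s :: real
  define u where "u s = g (e s)" for s
  have e: "e s \<in> {i} \<rightarrow>\<^sub>E UNIV" "e s \<in> orthant {i} \<longleftrightarrow> 0 \<le> s" for s
    by (auto simp: e_def orthant_iff)
  have [measurable]: "e \<in> lborel \<rightarrow>\<^sub>M Pi\<^sub>M {i} (\<lambda>_. lborel)"
    unfolding e_def by (rule measurable_restrict) auto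
  have [measurable]: "u \<in> borel_measurable borel"
    using measurable_compose[OF _ g.borel_measurable_density, of e lborel] unfolding u_def by simp
  have singleton: "(\<integral>\<^sup>+x. ennreal (g x) * \<phi> (x i) \<partial>Pi\<^sub>M {i} (\<lambda>_. lborel)) = (\<integral>\<^sup>+s. ennreal (u s) * \<phi> s \<partial>lborel)"
    if [measurable]: "\<phi> \<in> borel_measurable borel" for \<phi>
  proof -
    have "(\<integral>\<^sup>+x. ennreal (g x) * \<phi> (x i) \<partial>Pi\<^sub>M {i} (\<lambda>_. lborel)) =
      (\<integral>\<^sup>+x. ennreal (u (x i)) * \<phi> (x i) \<partial>Pi\<^sub>M {i} (\<lambda>_. lborel))"
    proof (rule nn_integral_cong)
      fix x :: "'i \<Rightarrow> real" assume "x \<in> space (Pi\<^sub>M {i} (\<lambda>_. lborel))"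
      then have "e (x i) = x"
        by (auto simp: space_PiM e_def fun_eq_iff PiE_iff extensional_def)
      then show "ennreal (g x) * \<phi> (x i) = ennreal (u (x i)) * \<phi> (x i)" by (simp add: u_def)
    qed
    also have "\<dots> = (\<integral>\<^sup>+s. ennreal (u s) * \<phi> s \<partial>lborel)"
      by (subst lborel_product.product_nn_integral_singleton[where f = "\<lambda>s. ennreal (u s) * \<phi> s"]) auto
    finally show ?thesis .
  qed
  have "real_dm_density u"
  proof
    show "0 \<le> u s" for s unfolding u_def by (rule g.nonneg) (rule e)
    show "u s = 0" if "s < 0" for s unfolding u_def using that e by (intro g.off_orthant) auto
    show "u t \<le> u s" if "0 \<le> s" "s \<le> t" for s t
      unfolding u_def using that e by (intro g.antimono) (auto simp: e_def)
    show "u s * u 0 \<le> (u (s / 2))\<^sup>2" for s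
    proof -
      have "(\<lambda>j\<in>{i}. e s j / 2) = e (s / 2)" by (auto simp: e_def fun_eq_iff)
      then show ?thesis using g.mult_origin_le[OF e(1)[of s]] by (simp add: u_def e_def[of 0])
    qed
    show "(\<integral>\<^sup>+s. ennreal (u s) \<partial>lborel) = 1"
      using singleton[of "\<lambda>_. 1"] g.total by simp
  qed measurable
  moreover have "(\<integral>\<^sup>+x. ennreal (f x) * \<phi> (x i) \<partial>Pi\<^sub>M I (\<lambda>_. lborel)) = (\<integral>\<^sup>+s. ennreal (u s) * \<phi> s \<partial>lborel)"
    if [measurable]: "\<phi> \<in> borel_measurable borel" for \<phi>
    using g[of "\<lambda>x. \<phi> (x i)"] singleton[OF that] by simp
  ultimately show ?thesis by (rule that)
qed

definition second_moment :: "'i \<Rightarrow> ennreal" where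
  "second_moment i = (\<integral>\<^sup>+x. ennreal (f x) * ennreal ((x i)\<^sup>2) \<partial>Pi\<^sub>M I (\<lambda>_. lborel))"

text \<open>An infinite second moment would give the value 0, as it does for the Bochner integral in
  \<open>sigma\<close>; \<open>second_moment_eq\<close> excludes this case.\<close>

definition rms :: "'i \<Rightarrow> real" where
  "rms i = sqrt (enn2real (second_moment i))"

text \<open>A distribution with a density has no atom at 0, so the second moment is positive; the
  bound 32/u(0)^2 makes it finite. The comparison with \<open>u 0\<close> is what
  \<open>nn_integral_inverse_sqrt_le\<close> asks for, with a constant independent of the
  density.\<close>

lemma rms_coordinate_marginal:
  assumes i: "i \<in> I" and "real_dm_density u"
    and u: "\<And>\<phi>. \<phi> \<in> borel_measurable borel \<Longrightarrow>
       (\<integral>\<^sup>+x. ennreal (f x) * \<phi> (x i) \<partial>Pi\<^sub>M I (\<lambda>_. lborel)) = (\<integral>\<^sup>+s. ennreal (u s) * \<phi> s \<partial>lborel)"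
  shows "0 < rms i" "second_moment i = ennreal ((rms i)\<^sup>2)" "rms i * u 0 \<le> 6"
proof -
  interpret u: real_dm_density u by fact
  have m: "second_moment i = (\<integral>\<^sup>+s. ennreal (u s * s\<^sup>2) \<partial>lborel)"
    unfolding second_moment_def using u.nonneg by (subst u[of "\<lambda>s. ennreal (s\<^sup>2)"]) (auto simp: ennreal_mult)
  then have le: "second_moment i \<le> ennreal (32 / (u 0)\<^sup>2)"
    using u.nn_integral_second_moment_le by simp
  have "second_moment i \<noteq> 0"
  proof
    assume "second_moment i = 0"
    then have "AE s in lborel. ennreal (u s * s\<^sup>2) = 0"
      unfolding m by (subst (asm) nn_integral_0_iff_AE) auto
    with AE_lborel_singleton[of "0::real"] have "AE s in lborel. ennreal (u s) = 0"
      by eventually_elim (use u.nonneg in \<open>auto simp: ennreal_eq_0_iff mult_le_0_iff\<close>)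
    then have "(\<integral>\<^sup>+s. ennreal (u s) \<partial>lborel) = 0" by (subst nn_integral_0_iff_AE) auto
    then show False using u.total by simp
  qed
  moreover obtain m' where m': "second_moment i = ennreal m'" "0 \<le> m'"
    using le by (cases "second_moment i") (auto simp: top_unique)
  ultimately have "0 < m'" by (auto simp: less_le)
  then show "0 < rms i" "second_moment i = ennreal ((rms i)\<^sup>2)"
    using m' by (auto simp: rms_def)
  have "m' \<le> 32 / (u 0)\<^sup>2" using le m' u.at_0_pos by simp
  \<comment> \<open>32 is rounded up to a square, which gives the constant 6.\<close>
  then have "rms i \<le> sqrt (36 / (u 0)\<^sup>2)"
    using m' \<open>0 < m'\<close> by (auto simp: rms_def intro!: order_trans[OF \<open>m' \<le> _\<close>] divide_right_mono)
  also have "\<dots> = 6 / u 0"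
    using u.at_0_pos by (simp add: real_sqrt_divide)
  finally show "rms i * u 0 \<le> 6" using u.at_0_pos by (simp add: field_simps)
qed

lemma
  assumes i: "i \<in> I"
  shows rms_pos: "0 < rms i" and second_moment_eq: "second_moment i = ennreal ((rms i)\<^sup>2)"
proof -
  obtain u where u: "real_dm_density u"
    "\<And>\<phi>. \<phi> \<in> borel_measurable borel \<Longrightarrow>
       (\<integral>\<^sup>+x. ennreal (f x) * \<phi> (x i) \<partial>Pi\<^sub>M I (\<lambda>_. lborel)) = (\<integral>\<^sup>+s. ennreal (u s) * \<phi> s \<partial>lborel)"
    using coordinate_marginal[OF i] by blast
  show "0 < rms i" "second_moment i = ennreal ((rms i)\<^sup>2)"
    using rms_coordinate_marginal[OF i u] by blast+
qed

lemma nn_integral_inverse_sqrt_coordinate_le: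
  assumes i: "i \<in> I"
  shows "(\<integral>\<^sup>+x. ennreal (f x) * ennreal (if x i \<le> 0 then c else sqrt (rms i / x i)) \<partial>Pi\<^sub>M I (\<lambda>_. lborel)) \<le> 13"
proof -
  obtain u where u: "real_dm_density u"
    "\<And>\<phi>. \<phi> \<in> borel_measurable borel \<Longrightarrow>
       (\<integral>\<^sup>+x. ennreal (f x) * \<phi> (x i) \<partial>Pi\<^sub>M I (\<lambda>_. lborel)) = (\<integral>\<^sup>+s. ennreal (u s) * \<phi> s \<partial>lborel)"
    using coordinate_marginal[OF i] by blast
  interpret u: real_dm_density u by fact
  have "(\<integral>\<^sup>+x. ennreal (f x) * ennreal (if x i \<le> 0 then c else sqrt (rms i / x i)) \<partial>Pi\<^sub>M I (\<lambda>_. lborel))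
     = (\<integral>\<^sup>+s. ennreal (u s * (if s \<le> 0 then c else sqrt (rms i / s))) \<partial>lborel)"
    using u.nonneg
    by (subst u(2)[of "\<lambda>s. ennreal (if s \<le> 0 then c else sqrt (rms i / s))"]) (auto simp: ennreal_mult')
  also have "\<dots> \<le> 13"
    using rms_coordinate_marginal[OF i u] by (intro u.nn_integral_inverse_sqrt_le) auto
  finally show ?thesis .
qed

text \<open>Jensen's inequality for the product \<open>P\<close> of the roots of x_i / rms_i takes
  the form exp z \<ge> 1 + z, with z equal to 13k minus the sum of the \<open>\<phi> i\<close>. Here
  \<open>\<phi> i\<close> dominates minus the logarithm of the i-th factor and has mean at most 13,
  so the linear part cancels and leaves 1 \<le> exp(13k) E P. Together with
  \<open>nn_integral_sqrt_le\<close> the root of the left-hand side is at most (2 exp 13)^k;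
  squaring gives the constant.\<close>

lemma origin_times_prod_rms_le:
  "f origin * (\<Prod>i\<in>I. rms i) \<le> (4 * exp 26) ^ card I"
proof -
  define k where "k = real (card I)"
  define \<phi> where "\<phi> i s = (if s \<le> 0 then 13 * k + 1 else sqrt (rms i / s))" for i and s :: real
  have \<phi>0: "0 \<le> \<phi> i s" if "i \<in> I" for i s
    using rms_pos[OF that] by (auto simp: \<phi>_def k_def)
  have [measurable]: "\<phi> i \<in> borel_measurable borel" for i unfolding \<phi>_def by measurable
  have [measurable]: "(\<lambda>x. x i) \<in> borel_measurable (Pi\<^sub>M I (\<lambda>_. lborel :: real measure))" if "i \<in> I" for i
    using measurable_component_singleton[OF that, of "\<lambda>_. lborel :: real measure"] by simp
  define P where "P x = (\<Prod>i\<in>I. sqrt (x i / rms i))" for x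
  have [measurable]: "P \<in> borel_measurable (Pi\<^sub>M I (\<lambda>_. lborel))"
    unfolding P_def by measurable
  have P0: "0 \<le> P x" if "x \<in> orthant I" for x
    using that rms_pos unfolding P_def
    by (intro prod_nonneg) (auto simp: orthant_iff less_imp_le)
  have tangent: "1 + 13 * k \<le> exp (13 * k) * P x + (\<Sum>i\<in>I. \<phi> i (x i))" if x: "x \<in> orthant I" for x
  proof (cases "\<exists>i\<in>I. x i = 0")
    case True
    then obtain i where i: "i \<in> I" "x i = 0" by auto
    then have "\<phi> i (x i) \<le> (\<Sum>i\<in>I. \<phi> i (x i))"
      using finite_index \<phi>0 by (intro member_le_sum) auto
    then show ?thesis using i P0[OF x] by (simp add: \<phi>_def add_increasing)
  next
    case False
    then have pos: "0 < x i" if "i \<in> I" for i using x that by (force simp: orthant_iff less_le)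
    have "exp (- \<phi> i (x i)) \<le> sqrt (x i / rms i)" if i: "i \<in> I" for i
    proof -
      \<comment> \<open>The inequality log y \<le> y, exponentiated and inverted:
        \<open>\<phi>\<close> bounds minus the logarithm of the i-th factor of
        \<open>P\<close>.\<close>
      define y where "y = sqrt (rms i / x i)"
      have y: "0 < y" using pos[OF i] rms_pos[OF i] by (simp add: y_def)
      have "y \<le> exp y" using exp_ge_add_one_self[of y] by linarith
      then have "exp (- y) \<le> 1 / y"
        using y by (simp add: exp_minus field_simps)
      then show ?thesis using pos[OF i] by (simp add: y_def \<phi>_def real_sqrt_divide)
    qed
    then have "(\<Prod>i\<in>I. exp (- \<phi> i (x i))) \<le> P x"
      unfolding P_def by (intro prod_mono) auto
    then have "exp (- (\<Sum>i\<in>I. \<phi> i (x i))) \<le> P x"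
      using exp_sum[OF finite_index, of "\<lambda>i. - \<phi> i (x i)"] by (simp add: sum_negf)
    then have "exp (13 * k) * exp (- (\<Sum>i\<in>I. \<phi> i (x i))) \<le> exp (13 * k) * P x"
      by (intro mult_left_mono) auto
    moreover have "1 + (13 * k - (\<Sum>i\<in>I. \<phi> i (x i))) \<le> exp (13 * k) * exp (- (\<Sum>i\<in>I. \<phi> i (x i)))"
      using exp_ge_add_one_self[of "13 * k - (\<Sum>i\<in>I. \<phi> i (x i))"] by (simp add: exp_diff exp_minus field_simps)
    ultimately show ?thesis by linarith
  qed
  have "ennreal (1 + 13 * k) = (\<integral>\<^sup>+x. ennreal (1 + 13 * k) * ennreal (f x) \<partial>Pi\<^sub>M I (\<lambda>_. lborel))"
    by (simp add: nn_integral_cmult total)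
  also have "\<dots> \<le> (\<integral>\<^sup>+x. ennreal (exp (13 * k)) * ennreal (f x * P x)
      + (\<Sum>i\<in>I. ennreal (f x) * ennreal (\<phi> i (x i))) \<partial>Pi\<^sub>M I (\<lambda>_. lborel))"
  proof (rule nn_integral_mono)
    fix x :: "'i \<Rightarrow> real" assume "x \<in> space (Pi\<^sub>M I (\<lambda>_. lborel))"
    then have x: "x \<in> I \<rightarrow>\<^sub>E UNIV" by (simp add: space_PiM)
    show "ennreal (1 + 13 * k) * ennreal (f x) \<le> ennreal (exp (13 * k)) * ennreal (f x * P x)
      + (\<Sum>i\<in>I. ennreal (f x) * ennreal (\<phi> i (x i)))"
    proof (cases "x \<in> orthant I")
      case True
      have "(1 + 13 * k) * f x \<le> (exp (13 * k) * P x + (\<Sum>i\<in>I. \<phi> i (x i))) * f x"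
        using tangent[OF True] nonneg[OF x] by (intro mult_right_mono) auto
      also have "\<dots> = exp (13 * k) * (f x * P x) + (\<Sum>i\<in>I. f x * \<phi> i (x i))"
        by (simp add: algebra_simps sum_distrib_left)
      finally have "ennreal ((1 + 13 * k) * f x) \<le> ennreal (exp (13 * k) * (f x * P x) + (\<Sum>i\<in>I. f x * \<phi> i (x i)))"
        by (rule ennreal_leI)
      also have "\<dots> = ennreal (exp (13 * k) * (f x * P x)) + ennreal (\<Sum>i\<in>I. f x * \<phi> i (x i))"
        using P0[OF True] nonneg[OF x] \<phi>0 by (intro ennreal_plus sum_nonneg mult_nonneg_nonneg) auto
      also have "\<dots> = ennreal (exp (13 * k)) * ennreal (f x * P x) + (\<Sum>i\<in>I. ennreal (f x) * ennreal (\<phi> i (x i)))"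
        using P0[OF True] nonneg[OF x] \<phi>0 by (simp add: ennreal_mult sum_ennreal flip: sum_ennreal)
      finally show ?thesis using nonneg[OF x] by (simp add: ennreal_mult k_def)
    next
      case False
      with x show ?thesis by (simp add: off_orthant)
    qed
  qed
  also have "\<dots> = ennreal (exp (13 * k)) * (\<integral>\<^sup>+x. ennreal (f x * P x) \<partial>Pi\<^sub>M I (\<lambda>_. lborel))
      + (\<Sum>i\<in>I. \<integral>\<^sup>+x. ennreal (f x) * ennreal (\<phi> i (x i)) \<partial>Pi\<^sub>M I (\<lambda>_. lborel))"
    by (simp add: nn_integral_add nn_integral_cmult nn_integral_sum)
  also have "\<dots> \<le> ennreal (exp (13 * k)) * (\<integral>\<^sup>+x. ennreal (f x * P x) \<partial>Pi\<^sub>M I (\<lambda>_. lborel)) + (\<Sum>i\<in>I. 13)"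
    unfolding \<phi>_def by (intro add_left_mono sum_mono nn_integral_inverse_sqrt_coordinate_le)
  also have "(\<Sum>i\<in>I. 13) = ennreal (13 * k)"
    by (simp add: k_def ennreal_mult ennreal_of_nat_eq_real_of_nat mult.commute)
  also have "ennreal (1 + 13 * k) = 1 + ennreal (13 * k)"
    by (simp add: k_def)
  finally have E: "1 \<le> ennreal (exp (13 * k)) * (\<integral>\<^sup>+x. ennreal (f x * P x) \<partial>Pi\<^sub>M I (\<lambda>_. lborel))"
    by (simp add: ennreal_add_left_cancel_le add.commute[of _ "ennreal (13 * k)"])
  \<comment> \<open>The root of the quantity to be bounded. In \<open>R * P x\<close> the factors
    \<open>rms i\<close> cancel, which leaves the root of the density at the origin times the
    product of the coordinates.\<close>
  define R where "R = sqrt (f origin * (\<Prod>i\<in>I. rms i))"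
  have R0: "0 \<le> R" using origin_pos rms_pos by (simp add: R_def prod_nonneg less_imp_le)
  have "ennreal R * (\<integral>\<^sup>+x. ennreal (f x * P x) \<partial>Pi\<^sub>M I (\<lambda>_. lborel))
     = (\<integral>\<^sup>+x. ennreal R * ennreal (f x * P x) \<partial>Pi\<^sub>M I (\<lambda>_. lborel))"
    by (simp add: nn_integral_cmult)
  also have "\<dots> \<le> (\<integral>\<^sup>+x. ennreal (sqrt (f x * f origin)) \<partial>Pi\<^sub>M I (\<lambda>_. lborel))"
  proof (rule nn_integral_mono)
    fix x :: "'i \<Rightarrow> real" assume "x \<in> space (Pi\<^sub>M I (\<lambda>_. lborel))"
    then have x: "x \<in> I \<rightarrow>\<^sub>E UNIV" by (simp add: space_PiM)
    have "R * (f x * P x) \<le> sqrt (f x * f origin)"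
    proof (cases "x \<in> orthant I")
      case True
      have "R * P x = sqrt (f origin * (\<Prod>i\<in>I. rms i) * (\<Prod>i\<in>I. x i / rms i))"
        by (simp add: R_def P_def real_sqrt_mult sqrt_prod)
      also have "f origin * (\<Prod>i\<in>I. rms i) * (\<Prod>i\<in>I. x i / rms i) = f origin * (\<Prod>i\<in>I. x i)"
      proof -
        have "(\<Prod>i\<in>I. rms i * (x i / rms i)) = (\<Prod>i\<in>I. x i)"
          by (rule prod.cong) (use rms_pos in force)+
        then show ?thesis by (simp only: prod.distrib mult.assoc)
      qed
      finally have "R * (f x * P x) = f x * sqrt (f origin * (\<Prod>i\<in>I. x i))"
        by (simp add: ac_simps)
      also have "\<dots> = sqrt (f x * f origin) * sqrt (f x * (\<Prod>i\<in>I. x i))"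
        using nonneg[OF x] by (simp add: real_sqrt_mult)
      also have "\<dots> \<le> sqrt (f x * f origin) * 1"
        using mult_prod_le_1[OF True] nonneg[OF x] origin_pos by (intro mult_left_mono) auto
      finally show ?thesis by simp
    next
      case False
      with x show ?thesis by (simp add: off_orthant)
    qed
    then show "ennreal R * ennreal (f x * P x) \<le> ennreal (sqrt (f x * f origin))"
      using R0 by (simp add: ennreal_leI flip: ennreal_mult')
  qed
  also have "\<dots> \<le> 2 ^ card I" by (rule nn_integral_sqrt_le)
  finally have "ennreal R * (\<integral>\<^sup>+x. ennreal (f x * P x) \<partial>Pi\<^sub>M I (\<lambda>_. lborel)) \<le> 2 ^ card I" .
  then have "ennreal (exp (13 * k)) * (ennreal R * (\<integral>\<^sup>+x. ennreal (f x * P x) \<partial>Pi\<^sub>M I (\<lambda>_. lborel)))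
      \<le> ennreal (exp (13 * k)) * 2 ^ card I"
    by (rule mult_left_mono) simp
  moreover have "ennreal R * 1 \<le> ennreal R * (ennreal (exp (13 * k)) * (\<integral>\<^sup>+x. ennreal (f x * P x) \<partial>Pi\<^sub>M I (\<lambda>_. lborel)))"
    using E by (rule mult_left_mono) simp
  ultimately have "ennreal R \<le> ennreal (exp (13 * k)) * 2 ^ card I"
    by (simp add: ac_simps)
  also have "\<dots> = ennreal (exp (13 * k) * 2 ^ card I)"
    by (simp add: ennreal_mult ennreal_power[symmetric])
  finally have "R \<le> exp (13 * k) * 2 ^ card I" by (subst (asm) ennreal_le_iff) auto
  then have "R\<^sup>2 \<le> (exp (13 * k) * 2 ^ card I)\<^sup>2" using R0 by (intro power_mono) auto
  also have "\<dots> = (4 * exp 26) ^ card I"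
  proof -
    have "exp (13 * k) = exp 13 ^ card I"
      using exp_of_nat_mult[of "card I" "13 :: real"] by (simp add: k_def mult.commute)
    then have "(exp (13 * k) * 2 ^ card I)\<^sup>2 = ((exp 13 * 2)\<^sup>2) ^ card I"
      by (simp only: power_mult_distrib[symmetric] power_mult[symmetric] mult.commute)
    also have "(exp 13 * 2)\<^sup>2 = 4 * exp (26 :: real)"
      using exp_double[of "13 :: real"] by (simp add: power_mult_distrib)
    finally show ?thesis .
  qed
  finally show ?thesis using origin_pos rms_pos
    by (simp add: R_def prod_nonneg less_imp_le)
qed

end

section \<open>Lower bound at the origin, joint tails at scale \<sigma>, and small boxes\<close>

context dm_density
begin

lemma one_le_pow_times_origin:
  assumes \<sigma>: "0 < \<sigma>" "\<And>i. i \<in> I \<Longrightarrow> rms i \<le> \<sigma>"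
  shows "1 \<le> (exp 1 * \<sigma>) ^ card I * f origin"
proof -
  define k where "k = real (card I)"
  have k0: "0 \<le> k" by (simp add: k_def)
  have [measurable]: "(\<lambda>x. x i) \<in> borel_measurable (Pi\<^sub>M I (\<lambda>_. lborel :: real measure))" if "i \<in> I" for i
    using measurable_component_singleton[OF that, of "\<lambda>_. lborel :: real measure"] by simp
  \<comment> \<open>The indicators turn the integral over the orthant into a product of
    one-dimensional integrals, each equal to \<sigma>.\<close>
  define h where "h x = (\<Prod>i\<in>I. exp (- x i / \<sigma>) * indicator {0..} (x i))" for x :: "'i \<Rightarrow> real"
  have h0: "0 \<le> h x" for x unfolding h_def by (intro prod_nonneg) auto
  have [measurable]: "h \<in> borel_measurable (Pi\<^sub>M I (\<lambda>_. lborel))" unfolding h_def by measurable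
  \<comment> \<open>Since s/\<sigma> \<le> (1 + (s/\<sigma>)^2)/2, the tangent inequality for exp
    can be integrated using second moments alone; the mean of \<open>q\<close> is at most 1 because
    \<open>rms i\<close> is at most \<sigma>.\<close>
  define q where "q s = (1 + (s / \<sigma>)\<^sup>2) / 2" for s
  have q0: "0 \<le> q s" for s by (simp add: q_def)
  have [measurable]: "q \<in> borel_measurable borel" unfolding q_def by measurable
  have q_int: "(\<integral>\<^sup>+x. ennreal (f x) * ennreal (q (x i)) \<partial>Pi\<^sub>M I (\<lambda>_. lborel)) \<le> 1" if i: "i \<in> I" for i
  proof -
    note [measurable] = i
    define c d :: real where "c = 1 / 2" and "d = 1 / (2 * \<sigma>\<^sup>2)"
    have cd: "0 \<le> c" "0 \<le> d" by (simp_all add: c_def d_def)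
    have "(\<integral>\<^sup>+x. ennreal (f x) * ennreal (q (x i)) \<partial>Pi\<^sub>M I (\<lambda>_. lborel)) =
      (\<integral>\<^sup>+x. ennreal c * ennreal (f x) + ennreal d * (ennreal (f x) * ennreal ((x i)\<^sup>2)) \<partial>Pi\<^sub>M I (\<lambda>_. lborel))"
    proof (rule nn_integral_cong)
      fix x :: "'i \<Rightarrow> real" assume "x \<in> space (Pi\<^sub>M I (\<lambda>_. lborel))"
      then have fx: "0 \<le> f x" by (simp add: space_PiM nonneg)
      have "f x * q (x i) = c * f x + d * (f x * (x i)\<^sup>2)"
        using \<sigma> by (simp add: q_def c_def d_def field_simps)
      then show "ennreal (f x) * ennreal (q (x i)) =
          ennreal c * ennreal (f x) + ennreal d * (ennreal (f x) * ennreal ((x i)\<^sup>2))"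
        using fx q0 cd by (simp flip: ennreal_mult ennreal_plus)
    qed
    also have "\<dots> = ennreal c + ennreal d * second_moment i"
      by (simp add: nn_integral_add nn_integral_cmult total second_moment_def)
    also have "\<dots> = ennreal (c + d * (rms i)\<^sup>2)"
      using cd by (simp add: second_moment_eq[OF i] flip: ennreal_mult ennreal_plus)
    also have "\<dots> \<le> ennreal 1"
    proof (rule ennreal_leI)
      have "(rms i)\<^sup>2 \<le> \<sigma>\<^sup>2" using \<sigma>(2)[OF i] rms_pos[OF i] by (intro power_mono) auto
      then show "c + d * (rms i)\<^sup>2 \<le> 1"
        using \<sigma> by (simp add: c_def d_def field_simps)
    qed
    finally show ?thesis by simp
  qed
  have tangent: "1 + k \<le> exp k * h x + (\<Sum>i\<in>I. q (x i))" if x: "x \<in> orthant I" for x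
  proof -
    define y where "y = (\<Sum>i\<in>I. x i / \<sigma>)"
    have "h x = (\<Prod>i\<in>I. exp (- (x i / \<sigma>)))"
      using x unfolding h_def by (intro prod.cong) (auto simp: orthant_iff)
    also have "\<dots> = exp (- y)"
      using exp_sum[OF finite_index, of "\<lambda>i. - (x i / \<sigma>)"] by (simp add: y_def sum_negf)
    finally have "exp k * h x = exp (k - y)" by (simp add: exp_diff exp_minus field_simps)
    moreover have "1 + (k - y) \<le> exp (k - y)" by (rule exp_ge_add_one_self)
    moreover have "y \<le> (\<Sum>i\<in>I. q (x i))"
      unfolding y_def
    proof (rule sum_mono)
      fix i
      show "x i / \<sigma> \<le> q (x i)"
        using sum_squares_bound[of 1 "x i / \<sigma>"] by (simp add: q_def mult.commute)
    qed
    ultimately show ?thesis by linarith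
  qed
  have "ennreal (1 + k) = (\<integral>\<^sup>+x. ennreal (1 + k) * ennreal (f x) \<partial>Pi\<^sub>M I (\<lambda>_. lborel))"
    by (simp add: nn_integral_cmult total)
  also have "\<dots> \<le> (\<integral>\<^sup>+x. ennreal (exp k) * ennreal (f x * h x)
      + (\<Sum>i\<in>I. ennreal (f x) * ennreal (q (x i))) \<partial>Pi\<^sub>M I (\<lambda>_. lborel))"
  proof (rule nn_integral_mono)
    fix x :: "'i \<Rightarrow> real" assume "x \<in> space (Pi\<^sub>M I (\<lambda>_. lborel))"
    then have x: "x \<in> I \<rightarrow>\<^sub>E UNIV" by (simp add: space_PiM)
    show "ennreal (1 + k) * ennreal (f x) \<le> ennreal (exp k) * ennreal (f x * h x)
      + (\<Sum>i\<in>I. ennreal (f x) * ennreal (q (x i)))"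
    proof (cases "x \<in> orthant I")
      case True
      have "(1 + k) * f x \<le> (exp k * h x + (\<Sum>i\<in>I. q (x i))) * f x"
        using tangent[OF True] nonneg[OF x] by (intro mult_right_mono) auto
      also have "\<dots> = exp k * (f x * h x) + (\<Sum>i\<in>I. f x * q (x i))"
        by (simp add: algebra_simps sum_distrib_left)
      finally have "ennreal ((1 + k) * f x) \<le> ennreal (exp k * (f x * h x) + (\<Sum>i\<in>I. f x * q (x i)))"
        by (rule ennreal_leI)
      also have "\<dots> = ennreal (exp k * (f x * h x)) + ennreal (\<Sum>i\<in>I. f x * q (x i))"
        using h0 nonneg[OF x] q0 by (intro ennreal_plus sum_nonneg mult_nonneg_nonneg) auto
      also have "ennreal (\<Sum>i\<in>I. f x * q (x i)) = (\<Sum>i\<in>I. ennreal (f x * q (x i)))"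
        using nonneg[OF x] q0 by (intro sum_ennreal[symmetric]) auto
      finally show ?thesis using nonneg[OF x] h0 q0 k0 by (simp add: ennreal_mult)
    next
      case False
      with x show ?thesis by (simp add: off_orthant)
    qed
  qed
  also have "\<dots> = ennreal (exp k) * (\<integral>\<^sup>+x. ennreal (f x * h x) \<partial>Pi\<^sub>M I (\<lambda>_. lborel))
      + (\<Sum>i\<in>I. \<integral>\<^sup>+x. ennreal (f x) * ennreal (q (x i)) \<partial>Pi\<^sub>M I (\<lambda>_. lborel))"
    by (simp add: nn_integral_add nn_integral_cmult nn_integral_sum)
  also have "\<dots> \<le> ennreal (exp k) * (\<integral>\<^sup>+x. ennreal (f x * h x) \<partial>Pi\<^sub>M I (\<lambda>_. lborel)) + (\<Sum>i\<in>I. 1)"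
    by (intro add_left_mono sum_mono q_int)
  also have "(\<Sum>i\<in>I. 1) = ennreal k"
    by (simp add: k_def ennreal_of_nat_eq_real_of_nat)
  also have "ennreal (1 + k) = 1 + ennreal k"
    using k0 by simp
  finally have "1 \<le> ennreal (exp k) * (\<integral>\<^sup>+x. ennreal (f x * h x) \<partial>Pi\<^sub>M I (\<lambda>_. lborel))"
    by (simp add: ennreal_add_left_cancel_le add.commute[of _ "ennreal k"])
  also have "(\<integral>\<^sup>+x. ennreal (f x * h x) \<partial>Pi\<^sub>M I (\<lambda>_. lborel))
      \<le> (\<integral>\<^sup>+x. ennreal (f origin) * (\<Prod>i\<in>I. ennreal (exp (- x i / \<sigma>) * indicator {0..} (x i))) \<partial>Pi\<^sub>M I (\<lambda>_. lborel))"
  proof (rule nn_integral_mono)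
    fix x :: "'i \<Rightarrow> real" assume "x \<in> space (Pi\<^sub>M I (\<lambda>_. lborel))"
    then have x: "x \<in> I \<rightarrow>\<^sub>E UNIV" by (simp add: space_PiM)
    have "f x * h x \<le> f origin * h x" using le_origin[OF x] h0 by (intro mult_right_mono) auto
    then have "ennreal (f x * h x) \<le> ennreal (f origin * h x)" by (rule ennreal_leI)
    also have "\<dots> = ennreal (f origin) * (\<Prod>i\<in>I. ennreal (exp (- x i / \<sigma>) * indicator {0..} (x i)))"
      using h0 origin_pos unfolding h_def by (subst prod_ennreal) (auto simp: ennreal_mult)
    finally show "ennreal (f x * h x) \<le> \<dots>" .
  qed
  also have "\<dots> = ennreal (f origin) * (\<Prod>i\<in>I. \<integral>\<^sup>+s. ennreal (exp (- s / \<sigma>) * indicator {0..} s) \<partial>lborel)"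
    using finite_index
    by (subst nn_integral_cmult, measurable)
      (subst lborel_product.product_nn_integral_prod[where f = "\<lambda>_ s. ennreal (exp (- s / \<sigma>) * indicator {0..} s)"], auto)
  also have "(\<integral>\<^sup>+s. ennreal (exp (- s / \<sigma>) * indicator {0..} s) \<partial>lborel) = ennreal \<sigma>"
  proof -
    have "(\<integral>\<^sup>+s. ennreal (exp (- s / \<sigma>)) * indicator {0..} s \<partial>lborel) = ennreal (0 - (- \<sigma> * exp (- 0 / \<sigma>)))"
    proof (rule nn_integral_FTC_atLeast)
      show "((\<lambda>s. - \<sigma> * exp (- s / \<sigma>)) \<longlongrightarrow> 0) at_top"
        using \<sigma> by real_asymp
      show "DERIV (\<lambda>s. - \<sigma> * exp (- s / \<sigma>)) s :> exp (- s / \<sigma>)" for s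
        using \<sigma> by (auto intro!: derivative_eq_intros)
    qed auto
    then show ?thesis by (simp add: ennreal_mult' ennreal_indicator)
  qed
  also have "ennreal (exp k) * (ennreal (f origin) * (\<Prod>i\<in>I. ennreal \<sigma>)) = ennreal (exp k * (f origin * \<sigma> ^ card I))"
    using origin_pos \<sigma> by (simp add: ennreal_mult ennreal_power)
  finally have "1 \<le> exp k * (f origin * \<sigma> ^ card I)"
    by (simp add: mult_left_mono)
  then show ?thesis
    by (simp add: k_def power_mult_distrib exp_of_nat_mult[symmetric] ac_simps)
qed

text \<open>Where all coordinates exceed a = 16 e \<sigma>, the bounds f(x) a^k \<le> 1 and 1 \<le>
  (e \<sigma>)^k f(0) give 16^k f(x) \<le> f(0), hence f(x) \<le> 4^(-k) sqrt(f(x) f(0)). The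
  integral of the root is at most 2^k, so 16 is what leaves a factor 1/2 per coordinate.\<close>

lemma nn_integral_all_large_le:
  assumes \<sigma>: "0 < \<sigma>" "\<And>i. i \<in> I \<Longrightarrow> rms i \<le> \<sigma>"
  shows "(\<integral>\<^sup>+x. ennreal (f x) * indicator {x. \<forall>i\<in>I. 16 * exp 1 * \<sigma> \<le> x i} x \<partial>Pi\<^sub>M I (\<lambda>_. lborel))
    \<le> ennreal ((1/2) ^ card I)"
proof -
  define a where "a = 16 * exp 1 * \<sigma>"
  have a: "0 < a" using \<sigma> by (simp add: a_def)
  have "(\<integral>\<^sup>+x. ennreal (f x) * indicator {x. \<forall>i\<in>I. a \<le> x i} x \<partial>Pi\<^sub>M I (\<lambda>_. lborel))
    \<le> (\<integral>\<^sup>+x. ennreal ((1/4) ^ card I) * ennreal (sqrt (f x * f origin)) \<partial>Pi\<^sub>M I (\<lambda>_. lborel))"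
  proof (rule nn_integral_mono)
    fix x :: "'i \<Rightarrow> real" assume "x \<in> space (Pi\<^sub>M I (\<lambda>_. lborel))"
    then have x: "x \<in> I \<rightarrow>\<^sub>E UNIV" by (simp add: space_PiM)
    have "f x \<le> (1/4) ^ card I * sqrt (f x * f origin)" if large: "\<forall>i\<in>I. a \<le> x i"
    proof -
      have xo: "x \<in> orthant I" using x large a by (force simp: orthant_iff)
      have "f x * a ^ card I \<le> f x * (\<Prod>i\<in>I. x i)"
        using large a nonneg[OF x] prod_mono[of I "\<lambda>_. a" x] by (intro mult_left_mono) auto
      also have "\<dots> \<le> 1" by (rule mult_prod_le_1[OF xo])
      also have "\<dots> \<le> (exp 1 * \<sigma>) ^ card I * f origin"
        using \<sigma> by (rule one_le_pow_times_origin)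
      finally have "16 ^ card I * f x \<le> f origin"
        using \<sigma> by (simp add: a_def power_mult_distrib mult.commute)
      then have "f x * (16 ^ card I * f x) \<le> f x * f origin"
        using nonneg[OF x] by (intro mult_left_mono)
      moreover have "(4 ^ card I * f x)\<^sup>2 = f x * (16 ^ card I * f x)"
        by (simp add: power2_eq_square power_mult_distrib[symmetric])
      ultimately have "4 ^ card I * f x \<le> sqrt (f x * f origin)"
        by (intro real_le_rsqrt) simp
      then show ?thesis by (simp add: power_divide field_simps)
    qed
    then show "ennreal (f x) * indicator {x. \<forall>i\<in>I. a \<le> x i} x
        \<le> ennreal ((1/4) ^ card I) * ennreal (sqrt (f x * f origin))"
      by (auto simp: indicator_def ennreal_leI simp flip: ennreal_mult')
  qed
  also have "\<dots> = ennreal ((1/4) ^ card I) * (\<integral>\<^sup>+x. ennreal (sqrt (f x * f origin)) \<partial>Pi\<^sub>M I (\<lambda>_. lborel))"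
    by (simp add: nn_integral_cmult)
  also have "\<dots> \<le> ennreal ((1/4) ^ card I) * 2 ^ card I"
    by (intro mult_left_mono nn_integral_sqrt_le) auto
  also have "\<dots> = ennreal ((1/4) ^ card I * 2 ^ card I)"
    by (simp add: ennreal_mult ennreal_power[symmetric])
  also have "(1/4) ^ card I * 2 ^ card I = (1/2 :: real) ^ card I"
    by (simp add: power_mult_distrib[symmetric])
  finally show ?thesis by (simp add: a_def)
qed

text \<open>Apart from points where the density vanishes, the event is a box of volume p^k, and the
  density there is at most its value at the origin.\<close>

lemma nn_integral_all_small_le:
  assumes \<sigma>: "0 < \<sigma>" "\<And>i. i \<in> I \<Longrightarrow> \<sigma> \<le> rms i" and p: "0 \<le> p"
  shows "(\<integral>\<^sup>+x. ennreal (f x) * indicator {x. \<forall>i\<in>I. x i \<le> p} x \<partial>Pi\<^sub>M I (\<lambda>_. lborel))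
    \<le> ennreal ((4 * exp 26 * p / \<sigma>) ^ card I)"
proof -
  have box: "Pi\<^sub>E I (\<lambda>i. {0..p}) \<in> sets (Pi\<^sub>M I (\<lambda>_. lborel))"
    using finite_index by (intro sets_PiM_I_finite) auto
  have "(\<integral>\<^sup>+x. ennreal (f x) * indicator {x. \<forall>i\<in>I. x i \<le> p} x \<partial>Pi\<^sub>M I (\<lambda>_. lborel))
    \<le> (\<integral>\<^sup>+x. ennreal (f origin) * indicator (Pi\<^sub>E I (\<lambda>i. {0..p})) x \<partial>Pi\<^sub>M I (\<lambda>_. lborel))"
  proof (rule nn_integral_mono)
    fix x :: "'i \<Rightarrow> real" assume "x \<in> space (Pi\<^sub>M I (\<lambda>_. lborel))"
    then have x: "x \<in> I \<rightarrow>\<^sub>E UNIV" by (simp add: space_PiM)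
    show "ennreal (f x) * indicator {x. \<forall>i\<in>I. x i \<le> p} x \<le> ennreal (f origin) * indicator (Pi\<^sub>E I (\<lambda>i. {0..p})) x"
    proof (cases "x \<in> orthant I")
      case True
      then have "(\<forall>i\<in>I. x i \<le> p) \<longleftrightarrow> x \<in> Pi\<^sub>E I (\<lambda>i. {0..p})"
        by (auto simp: orthant_iff PiE_iff)
      then show ?thesis using le_origin[OF x] by (simp add: indicator_def ennreal_leI)
    next
      case False
      with x show ?thesis by (simp add: off_orthant)
    qed
  qed
  also have "\<dots> = ennreal (f origin) * (\<Prod>i\<in>I. ennreal p)"
    using box finite_index p by (simp add: nn_integral_cmult_indicator lborel_product.emeasure_PiM)
  also have "\<dots> = ennreal (f origin * p ^ card I)"
    using origin_pos p by (simp add: ennreal_mult ennreal_power)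
  also have "\<dots> \<le> ennreal ((4 * exp 26 * p / \<sigma>) ^ card I)"
  proof (rule ennreal_leI)
    have "f origin * \<sigma> ^ card I \<le> f origin * (\<Prod>i\<in>I. rms i)"
      using origin_pos \<sigma> prod_mono[of I "\<lambda>_. \<sigma>" rms] by (intro mult_left_mono) auto
    also have "\<dots> \<le> (4 * exp 26) ^ card I" by (rule origin_times_prod_rms_le)
    finally have "f origin \<le> (4 * exp 26) ^ card I / \<sigma> ^ card I"
      using \<sigma> by (simp add: field_simps)
    then have "f origin * p ^ card I \<le> (4 * exp 26) ^ card I / \<sigma> ^ card I * p ^ card I"
      using p by (intro mult_right_mono) auto
    then show "f origin * p ^ card I \<le> (4 * exp 26 * p / \<sigma>) ^ card I"
      by (simp add: power_mult_distrib power_divide)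
  qed
  finally show ?thesis .
qed

text \<open>Root mean squares are unchanged in a marginal, so estimates for all coordinates of a
  density apply to any subset of coordinates.\<close>

lemma marginal_rms:
  assumes "J \<subseteq> I"
  obtains g where "dm_density J g" "\<And>i. i \<in> J \<Longrightarrow> dm_density.rms J g i = rms i"
    "\<And>\<phi>. \<phi> \<in> borel_measurable (Pi\<^sub>M J (\<lambda>_. lborel)) \<Longrightarrow>
       (\<integral>\<^sup>+x. ennreal (f x) * \<phi> (restrict x J) \<partial>Pi\<^sub>M I (\<lambda>_. lborel)) =
       (\<integral>\<^sup>+x. ennreal (g x) * \<phi> x \<partial>Pi\<^sub>M J (\<lambda>_. lborel))"
proof -
  obtain g where g: "dm_density J g" "\<And>\<phi>. \<phi> \<in> borel_measurable (Pi\<^sub>M J (\<lambda>_. lborel)) \<Longrightarrow>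
       (\<integral>\<^sup>+x. ennreal (f x) * \<phi> (restrict x J) \<partial>Pi\<^sub>M I (\<lambda>_. lborel)) =
       (\<integral>\<^sup>+x. ennreal (g x) * \<phi> x \<partial>Pi\<^sub>M J (\<lambda>_. lborel))"
    using dm_density_marginal[OF dm_density_axioms assms] by blast
  interpret g: dm_density J g by fact
  have "g.rms i = rms i" if i: "i \<in> J" for i
  proof -
    have "(\<lambda>x. ennreal ((x i)\<^sup>2)) \<in> borel_measurable (Pi\<^sub>M J (\<lambda>_. lborel :: real measure))"
      using measurable_component_singleton[OF i, of "\<lambda>_. lborel :: real measure"] by simp
    from g(2)[OF this] have "g.second_moment i = second_moment i"
      using i by (simp add: g.second_moment_def second_moment_def)
    then show ?thesis by (simp add: g.rms_def rms_def)
  qed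
  with g that show ?thesis by blast
qed

end

section \<open>Upper tails\<close>

text \<open>The mean of \<open>u\<close> over \<open>[t, a]\<close> is at most its mean over \<open>[0, a]\<close>.\<close>
lemma nn_integral_shift_le:
  fixes u :: "real \<Rightarrow> ennreal"
  assumes [measurable]: "u \<in> borel_measurable borel"
    and antimono: "\<And>s s'. 0 \<le> s \<Longrightarrow> s \<le> s' \<Longrightarrow> u s' \<le> u s" and t: "0 \<le> t" "t \<le> a" "0 < a"
  shows "(\<integral>\<^sup>+s. u s * indicator {t..} s \<partial>lborel) \<le> (\<integral>\<^sup>+s. u s * ennreal (if s \<le> a then 1 - t / a else 1) \<partial>lborel)"
proof -
  define A B C where "A = (\<integral>\<^sup>+s. u s * indicator {0..<t} s \<partial>lborel)"
    and "B = (\<integral>\<^sup>+s. u s * indicator {t..a} s \<partial>lborel)"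
    and "C = (\<integral>\<^sup>+s. u s * indicator {a<..} s \<partial>lborel)"
  have "B \<le> (\<integral>\<^sup>+s. u t * indicator {t..a} s \<partial>lborel)"
    unfolding B_def using antimono t by (intro nn_integral_mono) (auto simp: indicator_def)
  also have "\<dots> = u t * ennreal (a - t)"
    using t by (simp add: nn_integral_cmult_indicator)
  finally have B: "B \<le> u t * ennreal (a - t)" .
  have "u t * ennreal t = (\<integral>\<^sup>+s. u t * indicator {0..<t} s \<partial>lborel)"
    using t by (simp add: nn_integral_cmult_indicator)
  also have "\<dots> \<le> A"
    unfolding A_def using antimono by (intro nn_integral_mono) (auto simp: indicator_def)
  finally have A: "u t * ennreal t \<le> A" .
  \<comment> \<open>The value \<open>u t\<close> separates the two intervals. It is eliminated by
    cross multiplication rather than division because it may be 0 or infinite.\<close>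
  have "ennreal t * B \<le> ennreal t * (u t * ennreal (a - t))"
    by (intro mult_left_mono B) auto
  also have "\<dots> = ennreal (a - t) * (u t * ennreal t)" by (simp add: ac_simps)
  also have "\<dots> \<le> ennreal (a - t) * A" by (intro mult_left_mono A) auto
  finally have tB: "ennreal t * B \<le> ennreal (a - t) * A" .
  have "ennreal a * B = ennreal t * B + ennreal (a - t) * B"
    using t by (simp add: distrib_right[symmetric] ennreal_plus[symmetric] del: ennreal_plus)
  also have "\<dots> \<le> ennreal (a - t) * A + ennreal (a - t) * B"
    using tB by (intro add_right_mono)
  finally have "ennreal (1 / a) * (ennreal a * B) \<le> ennreal (1 / a) * (ennreal (a - t) * (A + B))"
    by (intro mult_left_mono) (auto simp: distrib_left)
  moreover have "ennreal (1 / a) * (ennreal a * B) = B"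
    using t by (simp add: mult.assoc[symmetric] ennreal_mult'[symmetric])
  moreover have "ennreal (1 / a) * (ennreal (a - t) * (A + B)) = ennreal (1 - t / a) * (A + B)"
    using t by (simp add: mult.assoc[symmetric] ennreal_mult'[symmetric] diff_divide_distrib)
  ultimately have key: "B \<le> ennreal (1 - t / a) * (A + B)" by simp
  have "(\<integral>\<^sup>+s. u s * indicator {t..} s \<partial>lborel) = (\<integral>\<^sup>+s. u s * indicator {t..a} s + u s * indicator {a<..} s \<partial>lborel)"
    using t by (intro nn_integral_cong) (auto simp: indicator_def)
  also have "\<dots> = B + C" unfolding B_def C_def by (simp add: nn_integral_add)
  also have "\<dots> \<le> ennreal (1 - t / a) * (A + B) + C" by (intro add_right_mono key)
  also have "\<dots> = (\<integral>\<^sup>+s. ennreal (1 - t / a) * (u s * indicator {0..<t} s + u s * indicator {t..a} s)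
      + u s * indicator {a<..} s \<partial>lborel)"
    unfolding A_def B_def C_def by (simp add: nn_integral_add nn_integral_cmult)
  also have "\<dots> \<le> (\<integral>\<^sup>+s. u s * ennreal (if s \<le> a then 1 - t / a else 1) \<partial>lborel)"
    using t by (intro nn_integral_mono) (auto simp: indicator_def mult.commute)
  finally show ?thesis .
qed

text \<open>The one-dimensional estimate is applied to one coordinate after another. The function is
  an arbitrary decreasing one with values in \<open>ennreal\<close> because the induction hypothesis
  is used for the weighted fibre integral \<open>\<Phi>\<close>, which is no longer a probability
  density.\<close>

lemma nn_integral_PiM_shift_le:
  fixes \<phi> :: "('i \<Rightarrow> real) \<Rightarrow> ennreal"
  assumes "finite J" "\<phi> \<in> borel_measurable (Pi\<^sub>M J (\<lambda>_. lborel))"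
    and "\<And>x y. x \<in> orthant J \<Longrightarrow> y \<in> orthant J \<Longrightarrow> (\<And>i. i \<in> J \<Longrightarrow> x i \<le> y i) \<Longrightarrow> \<phi> y \<le> \<phi> x"
    and "\<And>x. x \<in> J \<rightarrow>\<^sub>E UNIV \<Longrightarrow> x \<notin> orthant J \<Longrightarrow> \<phi> x = 0"
    and t: "0 \<le> t" "t \<le> a" "0 < a"
  shows "(\<integral>\<^sup>+x. \<phi> x * (\<Prod>i\<in>J. indicator {t..} (x i)) \<partial>Pi\<^sub>M J (\<lambda>_. lborel))
    \<le> (\<integral>\<^sup>+x. \<phi> x * (\<Prod>i\<in>J. ennreal (if x i \<le> a then 1 - t / a else 1)) \<partial>Pi\<^sub>M J (\<lambda>_. lborel))"
  using assms(1-4)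
proof (induction J arbitrary: \<phi> rule: finite_induct)
  case empty
  then show ?case by simp
next
  case (insert i J)
  note insert.prems(1)[measurable] insert.hyps(1)[simp]
  have anti: "\<phi> y \<le> \<phi> x"
    if "x \<in> orthant (insert i J)" "y \<in> orthant (insert i J)" "\<And>j. j \<in> insert i J \<Longrightarrow> x j \<le> y j" for x y
    using insert.prems(2)[OF that] by simp
  have off: "\<phi> x = 0" if "x \<in> insert i J \<rightarrow>\<^sub>E UNIV" "x \<notin> orthant (insert i J)" for x
    using insert.prems(3)[OF that] by simp
  define w where "w s = ennreal (if s \<le> a then 1 - t / a else 1)" for s
  have [measurable]: "w \<in> borel_measurable borel" unfolding w_def by measurable
  have [measurable]: "(\<lambda>x. x j) \<in> borel_measurable (Pi\<^sub>M J' (\<lambda>_. lborel :: real measure))" if "j \<in> J'" for j and J' :: "'i set"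
    using measurable_component_singleton[OF that, of "\<lambda>_. lborel :: real measure"] by simp
  have upd: "x(i := s) \<in> insert i J \<rightarrow>\<^sub>E UNIV" if "x \<in> J \<rightarrow>\<^sub>E UNIV" for x :: "'i \<Rightarrow> real" and s
    using that by (auto simp: PiE_iff extensional_def)
  have orth: "x(i := s) \<in> orthant (insert i J) \<longleftrightarrow> x \<in> orthant J \<and> 0 \<le> s"
    if "x \<in> J \<rightarrow>\<^sub>E UNIV" for x :: "'i \<Rightarrow> real" and s
    using that upd[OF that] insert.hyps by (auto simp: orthant_iff)
  have meas: "(\<lambda>s. \<phi> (x(i := s))) \<in> borel_measurable borel" if "x \<in> J \<rightarrow>\<^sub>E UNIV" for x
    using that by (rule borel_measurable_fun_upd_component[OF insert.prems(1)])
  define \<Phi> where "\<Phi> x = (\<integral>\<^sup>+s. \<phi> (x(i := s)) * w s \<partial>lborel)" for x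
  have [measurable]: "\<Phi> \<in> borel_measurable (Pi\<^sub>M J (\<lambda>_. lborel))" unfolding \<Phi>_def by measurable
  have prod_upd: "(\<Prod>j\<in>insert i J. F ((x(i := s)) j)) = F s * (\<Prod>j\<in>J. F (x j))" for F :: "real \<Rightarrow> ennreal" and x s
    using insert.hyps by (auto intro!: arg_cong2[where f = times] prod.cong)
  have "(\<integral>\<^sup>+x. \<phi> x * (\<Prod>i\<in>insert i J. indicator {t..} (x i)) \<partial>Pi\<^sub>M (insert i J) (\<lambda>_. lborel))
      = (\<integral>\<^sup>+x. (\<integral>\<^sup>+s. \<phi> (x(i := s)) * (indicator {t..} s * (\<Prod>j\<in>J. indicator {t..} (x j))) \<partial>lborel) \<partial>Pi\<^sub>M J (\<lambda>_. lborel))"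
    using insert.hyps by (subst lborel_product.product_nn_integral_insert) (auto simp only: prod_upd, measurable)
  also have "\<dots> \<le> (\<integral>\<^sup>+x. \<Phi> x * (\<Prod>j\<in>J. indicator {t..} (x j)) \<partial>Pi\<^sub>M J (\<lambda>_. lborel))"
  proof (rule nn_integral_mono)
    fix x :: "'i \<Rightarrow> real" assume "x \<in> space (Pi\<^sub>M J (\<lambda>_. lborel))"
    then have x: "x \<in> J \<rightarrow>\<^sub>E UNIV" by (simp add: space_PiM)
    note [measurable] = meas[OF x]
    have le: "(\<integral>\<^sup>+s. \<phi> (x(i := s)) * indicator {t..} s \<partial>lborel) \<le> \<Phi> x"
      unfolding \<Phi>_def w_def
    proof (rule nn_integral_shift_le[OF _ _ t])
      fix s s' :: real assume s: "0 \<le> s" "s \<le> s'"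
      show "\<phi> (x(i := s')) \<le> \<phi> (x(i := s))"
      proof (cases "x \<in> orthant J")
        case True
        with s orth[OF x] show ?thesis
          using anti[of "x(i := s)" "x(i := s')"] by simp
      next
        case False
        with s x upd[OF x] orth[OF x] show ?thesis by (simp add: off)
      qed
    qed measurable
    have "(\<integral>\<^sup>+s. \<phi> (x(i := s)) * (indicator {t..} s * (\<Prod>j\<in>J. indicator {t..} (x j))) \<partial>lborel)
      = (\<integral>\<^sup>+s. \<phi> (x(i := s)) * indicator {t..} s \<partial>lborel) * (\<Prod>j\<in>J. indicator {t..} (x j))"
      by (subst nn_integral_multc[symmetric]) (auto simp: ac_simps)
    also have "\<dots> \<le> \<Phi> x * (\<Prod>j\<in>J. indicator {t..} (x j))"
      using le by (rule mult_right_mono) simp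
    finally show "(\<integral>\<^sup>+s. \<phi> (x(i := s)) * (indicator {t..} s * (\<Prod>j\<in>J. indicator {t..} (x j))) \<partial>lborel)
      \<le> \<Phi> x * (\<Prod>j\<in>J. indicator {t..} (x j))" .
  qed
  also have "\<dots> \<le> (\<integral>\<^sup>+x. \<Phi> x * (\<Prod>j\<in>J. w (x j)) \<partial>Pi\<^sub>M J (\<lambda>_. lborel))"
    unfolding w_def
  proof (rule insert.IH)
    show "\<Phi> y \<le> \<Phi> x" if "x \<in> orthant J" "y \<in> orthant J" "\<And>j. j \<in> J \<Longrightarrow> x j \<le> y j" for x y
      unfolding \<Phi>_def
    proof (intro nn_integral_mono mult_right_mono)
      fix s
      have xy: "x \<in> J \<rightarrow>\<^sub>E UNIV" "y \<in> J \<rightarrow>\<^sub>E UNIV" using that by (auto simp: orthant_iff)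
      show "\<phi> (y(i := s)) \<le> \<phi> (x(i := s))"
      proof (cases "0 \<le> s")
        case True
        with that orth[OF xy(1)] orth[OF xy(2)] show ?thesis
          by (intro anti[of "x(i := s)" "y(i := s)"]) auto
      next
        case False
        then show ?thesis using upd xy orth by (simp add: off)
      qed
    qed auto
    show "\<Phi> x = 0" if "x \<in> J \<rightarrow>\<^sub>E UNIV" "x \<notin> orthant J" for x
      unfolding \<Phi>_def using that upd orth by (simp add: off)
  qed measurable
  also have "\<dots> = (\<integral>\<^sup>+x. (\<integral>\<^sup>+s. \<phi> (x(i := s)) * (w s * (\<Prod>j\<in>J. w (x j))) \<partial>lborel) \<partial>Pi\<^sub>M J (\<lambda>_. lborel))"
  proof (rule nn_integral_cong)
    fix x :: "'i \<Rightarrow> real" assume "x \<in> space (Pi\<^sub>M J (\<lambda>_. lborel))"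
    then have x: "x \<in> J \<rightarrow>\<^sub>E UNIV" by (simp add: space_PiM)
    note [measurable] = meas[OF x]
    show "\<Phi> x * (\<Prod>j\<in>J. w (x j)) = (\<integral>\<^sup>+s. \<phi> (x(i := s)) * (w s * (\<Prod>j\<in>J. w (x j))) \<partial>lborel)"
      unfolding \<Phi>_def by (subst nn_integral_multc[symmetric]) (auto simp: ac_simps)
  qed
  also have "\<dots> = (\<integral>\<^sup>+x. \<phi> x * (\<Prod>i\<in>insert i J. w (x i)) \<partial>Pi\<^sub>M (insert i J) (\<lambda>_. lborel))"
    using insert.hyps by (subst lborel_product.product_nn_integral_insert) (auto simp only: prod_upd, measurable)
  finally show ?case unfolding w_def .
qed

text \<open>With q = 1 - t/a, each coordinate carries a weight at most q, plus 1 - q if it is at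
  least a. In the expanded product the subset \<open>J\<close> of large coordinates has the event
  \<open>L J\<close>, which concerns only the marginal on \<open>J\<close> and has probability at
  most (1/2)^|J|. Summing up again gives (q + (1 - q)/2)^k, and q + (1 - q)/2 = 1 - t/(2a).\<close>

lemma (in dm_density) nn_integral_all_at_least_le:
  assumes \<sigma>: "0 < \<sigma>" "\<And>i. i \<in> I \<Longrightarrow> rms i \<le> \<sigma>" and t: "0 \<le> t" "t \<le> 16 * exp 1 * \<sigma>"
  shows "(\<integral>\<^sup>+x. ennreal (f x) * indicator {x. \<forall>i\<in>I. t \<le> x i} x \<partial>Pi\<^sub>M I (\<lambda>_. lborel))
    \<le> ennreal ((1 - t / (32 * exp 1 * \<sigma>)) ^ card I)"
proof -
  define a q where "a = 16 * exp 1 * \<sigma>" and "q = 1 - t / a"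
  have a: "0 < a" using \<sigma> by (simp add: a_def)
  have q: "0 \<le> q" "q \<le> 1" using a t by (simp_all add: q_def a_def[symmetric])
  define L where "L J = {x. \<forall>i\<in>J. a \<le> x i}" for J :: "'i set"
  have L_sets: "{x \<in> space (Pi\<^sub>M J' (\<lambda>_. lborel)). x \<in> L J} \<in> sets (Pi\<^sub>M J' (\<lambda>_. lborel))" if "J \<subseteq> J'" "finite J'" for J J'
    unfolding L_def using that by (auto intro!: sets.sets_Collect_finite_All finite_subset[OF that] simp: subset_iff)
  have L_meas: "(indicator (L J) :: _ \<Rightarrow> ennreal) \<in> borel_measurable (Pi\<^sub>M J' (\<lambda>_. lborel))" if "J \<subseteq> J'" "finite J'" for J J'
    using L_sets[OF that] by (subst borel_measurable_indicator_iff) (simp add: Int_def conj_commute)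
  have large: "(\<integral>\<^sup>+x. ennreal (f x) * indicator (L J) x \<partial>Pi\<^sub>M I (\<lambda>_. lborel)) \<le> ennreal ((1/2) ^ card J)"
    if J: "J \<subseteq> I" for J
  proof -
    obtain g where g: "dm_density J g" "\<And>i. i \<in> J \<Longrightarrow> dm_density.rms J g i = rms i"
      "\<And>\<phi>. \<phi> \<in> borel_measurable (Pi\<^sub>M J (\<lambda>_. lborel)) \<Longrightarrow>
       (\<integral>\<^sup>+x. ennreal (f x) * \<phi> (restrict x J) \<partial>Pi\<^sub>M I (\<lambda>_. lborel)) =
       (\<integral>\<^sup>+x. ennreal (g x) * \<phi> x \<partial>Pi\<^sub>M J (\<lambda>_. lborel))"
      using marginal_rms[OF J] by blast
    interpret g: dm_density J g by fact
    have "(\<integral>\<^sup>+x. ennreal (f x) * indicator (L J) x \<partial>Pi\<^sub>M I (\<lambda>_. lborel)) =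
        (\<integral>\<^sup>+x. ennreal (f x) * indicator (L J) (restrict x J) \<partial>Pi\<^sub>M I (\<lambda>_. lborel))"
      by (intro nn_integral_cong) (simp add: L_def indicator_def)
    also have "\<dots> = (\<integral>\<^sup>+x. ennreal (g x) * indicator (L J) x \<partial>Pi\<^sub>M J (\<lambda>_. lborel))"
      by (intro g(3) L_meas g.finite_index) auto
    also have "\<dots> \<le> ennreal ((1/2) ^ card J)"
      unfolding L_def a_def using \<sigma> g(2) J by (intro g.nn_integral_all_large_le) auto
    finally show ?thesis .
  qed
  have "(\<integral>\<^sup>+x. ennreal (f x) * indicator {x. \<forall>i\<in>I. t \<le> x i} x \<partial>Pi\<^sub>M I (\<lambda>_. lborel))
     = (\<integral>\<^sup>+x. ennreal (f x) * (\<Prod>i\<in>I. indicator {t..} (x i)) \<partial>Pi\<^sub>M I (\<lambda>_. lborel))"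
    using finite_index by (intro nn_integral_cong arg_cong2[where f = times]) (auto simp: indicator_def prod_zero_iff)
  also have "\<dots> \<le> (\<integral>\<^sup>+x. ennreal (f x) * (\<Prod>i\<in>I. ennreal (if x i \<le> a then 1 - t / a else 1)) \<partial>Pi\<^sub>M I (\<lambda>_. lborel))"
    using finite_index t a by (intro nn_integral_PiM_shift_le) (auto simp: antimono off_orthant a_def intro!: ennreal_leI)
  also have "\<dots> \<le> (\<integral>\<^sup>+x. (\<Sum>J\<in>Pow I. ennreal ((1 - q) ^ card J * q ^ card (I - J)) * (ennreal (f x) * indicator (L J) x)) \<partial>Pi\<^sub>M I (\<lambda>_. lborel))"
  proof (rule nn_integral_mono)
    fix x :: "'i \<Rightarrow> real"
    \<comment> \<open>Only an inequality, because both alternatives hold at x_i = a; the closed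
      condition on the right matches the events \<open>L J\<close>.\<close>
    have "(\<Prod>i\<in>I. ennreal (if x i \<le> a then 1 - t / a else 1)) \<le> (\<Prod>i\<in>I. ennreal (1 - q) * indicator {a..} (x i) + ennreal q)"
    proof (rule prod_mono_ennreal)
      fix i
      have "ennreal (1 - q) + ennreal q = 1"
        using q by (subst ennreal_plus[symmetric]) auto
      then show "ennreal (if x i \<le> a then 1 - t / a else 1) \<le> ennreal (1 - q) * indicator {a..} (x i) + ennreal q"
        by (auto simp: indicator_def q_def[symmetric])
    qed
    also have "\<dots> = (\<Sum>J\<in>Pow I. (\<Prod>i\<in>J. ennreal (1 - q) * indicator {a..} (x i)) * (\<Prod>i\<in>I - J. ennreal q))"
      using finite_index by (rule prod_add)
    also have "\<dots> = (\<Sum>J\<in>Pow I. ennreal ((1 - q) ^ card J * q ^ card (I - J)) * indicator (L J) x)"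
    proof (rule sum.cong)
      fix J assume "J \<in> Pow I"
      then have "finite J" using finite_index finite_subset by auto
      then have "(\<Prod>i\<in>J. indicator {a..} (x i)) = (indicator (L J) x :: ennreal)"
        by (auto simp: L_def indicator_def prod_zero_iff)
      then show "(\<Prod>i\<in>J. ennreal (1 - q) * indicator {a..} (x i)) * (\<Prod>i\<in>I - J. ennreal q)
          = ennreal ((1 - q) ^ card J * q ^ card (I - J)) * indicator (L J) x"
        using q by (simp add: prod.distrib ennreal_mult ennreal_power[symmetric] ac_simps)
    qed simp
    finally have "ennreal (f x) * (\<Prod>i\<in>I. ennreal (if x i \<le> a then 1 - t / a else 1))
      \<le> ennreal (f x) * (\<Sum>J\<in>Pow I. ennreal ((1 - q) ^ card J * q ^ card (I - J)) * indicator (L J) x)"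
      by (rule mult_left_mono) simp
    then show "ennreal (f x) * (\<Prod>i\<in>I. ennreal (if x i \<le> a then 1 - t / a else 1))
      \<le> (\<Sum>J\<in>Pow I. ennreal ((1 - q) ^ card J * q ^ card (I - J)) * (ennreal (f x) * indicator (L J) x))"
      by (simp add: sum_distrib_left ac_simps)
  qed
  also have "\<dots> = (\<Sum>J\<in>Pow I. ennreal ((1 - q) ^ card J * q ^ card (I - J)) * (\<integral>\<^sup>+x. ennreal (f x) * indicator (L J) x \<partial>Pi\<^sub>M I (\<lambda>_. lborel)))"
    using finite_index L_meas by (subst nn_integral_sum) (auto simp: nn_integral_cmult)
  also have "\<dots> \<le> (\<Sum>J\<in>Pow I. ennreal ((1 - q) ^ card J * q ^ card (I - J)) * ennreal ((1/2) ^ card J))"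
    by (intro sum_mono mult_left_mono large) auto
  also have "\<dots> = (\<Sum>J\<in>Pow I. ennreal ((\<Prod>i\<in>J. (1 - q) / 2) * (\<Prod>i\<in>I - J. q)))"
    using q by (intro sum.cong) (auto simp: power_divide power_one_over field_simps simp flip: ennreal_mult)
  also have "\<dots> = ennreal (\<Sum>J\<in>Pow I. (\<Prod>i\<in>J. (1 - q) / 2) * (\<Prod>i\<in>I - J. q))"
    using q by (intro sum_ennreal) auto
  \<comment> \<open>The same expansion read backwards, with the factors 1/2 absorbed into the
    weights 1 - q.\<close>
  also have "(\<Sum>J\<in>Pow I. (\<Prod>i\<in>J. (1 - q) / 2) * (\<Prod>i\<in>I - J. q)) = (\<Prod>i\<in>I. (1 - q) / 2 + q)"
    using finite_index by (rule prod_add[symmetric])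
  also have "\<dots> = (1 - t / (32 * exp 1 * \<sigma>)) ^ card I"
    using \<sigma> by (simp add: q_def a_def field_simps)
  finally show ?thesis .
qed

section \<open>Transfer to distributions\<close>

lemma dm_logconcave_distributionE:
  assumes F: "dm_logconcave_distribution I F" and "finite I"
  obtains f where "dm_density I f" "F = density (Pi\<^sub>M I (\<lambda>_. lborel)) (\<lambda>x. ennreal (f x))"
    "\<And>i. i \<in> I \<Longrightarrow> dm_density.rms I f i = sigma F i"
proof -
  interpret prob_space F using F by (simp add: dm_logconcave_distribution_def)
  obtain f where f[measurable]: "f \<in> borel_measurable (Pi\<^sub>M I (\<lambda>_. lborel))"
    and F_eq: "F = density (Pi\<^sub>M I (\<lambda>_. lborel)) (\<lambda>x. ennreal (f x))"
    and lc: "logconcave I f" and off: "\<forall>x \<in> (I \<rightarrow>\<^sub>E UNIV) - orthant I. f x = 0" and dm: "down_monotone I f"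
    using F by (auto simp: dm_logconcave_distribution_def)
  have nonneg: "0 \<le> f x" if "x \<in> I \<rightarrow>\<^sub>E UNIV" for x using lc that by (simp add: logconcave_def)
  have density: "dm_density I f"
  proof
    show "f x * f y \<le> (f (\<lambda>i\<in>I. (x i + y i) / 2))\<^sup>2" if "x \<in> orthant I" "y \<in> orthant I" for x y
    proof -
      have xy: "x \<in> I \<rightarrow>\<^sub>E UNIV" "y \<in> I \<rightarrow>\<^sub>E UNIV" using that by (auto simp: orthant_iff)
      have "sqrt (f x) * sqrt (f y) = f x powr (1/2) * f y powr (1 - 1/2)"
        using nonneg[OF xy(1)] nonneg[OF xy(2)] by (simp add: powr_half_sqrt)
      also have "\<dots> \<le> f (\<lambda>i\<in>I. 1/2 * x i + (1 - 1/2) * y i)"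
        using lc xy unfolding logconcave_def by (elim conjE) (drule bspec, assumption, drule bspec, assumption, drule bspec[of _ _ "1/2"], auto)
      also have "(\<lambda>i\<in>I. 1/2 * x i + (1 - 1/2) * y i) = (\<lambda>i\<in>I. (x i + y i) / 2)"
        by (auto simp: fun_eq_iff add_divide_distrib)
      finally have "sqrt (f x) * sqrt (f y) \<le> f (\<lambda>i\<in>I. (x i + y i) / 2)" .
      then have "(sqrt (f x) * sqrt (f y))\<^sup>2 \<le> (f (\<lambda>i\<in>I. (x i + y i) / 2))\<^sup>2"
        using nonneg[OF xy(1)] nonneg[OF xy(2)] by (intro power_mono) auto
      then show ?thesis using nonneg[OF xy(1)] nonneg[OF xy(2)] by (simp add: power_mult_distrib)
    qed
    show "(\<integral>\<^sup>+x. ennreal (f x) \<partial>Pi\<^sub>M I (\<lambda>_. lborel)) = 1"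
      using emeasure_space_1 unfolding F_eq by (simp add: emeasure_density cong: nn_integral_cong)
    show "f y \<le> f x" if "x \<in> orthant I" "y \<in> orthant I" "\<And>i. i \<in> I \<Longrightarrow> x i \<le> y i" for x y
      using dm that by (simp add: down_monotone_def)
    show "f x = 0" if "x \<in> I \<rightarrow>\<^sub>E UNIV" "x \<notin> orthant I" for x
      using off that by auto
  qed (use assms nonneg in auto)
  interpret dm_density I f by fact
  have "rms i = sigma F i" if [measurable]: "i \<in> I" for i
  proof -
    have [measurable]: "(\<lambda>x. x i) \<in> borel_measurable (Pi\<^sub>M I (\<lambda>_. lborel :: real measure))"
      using measurable_component_singleton[OF that, of "\<lambda>_. lborel :: real measure"] by simp
    \<comment> \<open>This holds before finiteness is known: if the integral diverges, both sides
      are 0.\<close>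
    have "(\<integral>x. (x i)\<^sup>2 \<partial>F) = enn2real (\<integral>\<^sup>+x. ennreal ((x i)\<^sup>2) \<partial>F)"
      by (rule integral_eq_nn_integral) (auto simp: F_eq)
    also have "(\<integral>\<^sup>+x. ennreal ((x i)\<^sup>2) \<partial>F) = second_moment i"
      by (simp add: F_eq nn_integral_density second_moment_def)
    finally show ?thesis by (simp add: rms_def sigma_def)
  qed
  with density F_eq show ?thesis by (rule that)
qed

lemma sets_Collect_all_coordinates:
  assumes "finite S" "S \<subseteq> I"
  shows "{x \<in> space (Pi\<^sub>M I (\<lambda>_. lborel)). \<forall>i\<in>S. x i \<le> (c :: real)} \<in> sets (Pi\<^sub>M I (\<lambda>_. lborel))"
    and "{x \<in> space (Pi\<^sub>M I (\<lambda>_. lborel)). \<forall>i\<in>S. (c :: real) \<le> x i} \<in> sets (Pi\<^sub>M I (\<lambda>_. lborel))"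
proof -
  have [measurable]: "(\<lambda>x. x i) \<in> borel_measurable (Pi\<^sub>M I (\<lambda>_. lborel :: real measure))" if "i \<in> S" for i
    using measurable_component_singleton[of i I "\<lambda>_. lborel :: real measure"] that assms by auto
  show "{x \<in> space (Pi\<^sub>M I (\<lambda>_. lborel)). \<forall>i\<in>S. x i \<le> (c :: real)} \<in> sets (Pi\<^sub>M I (\<lambda>_. lborel))"
    "{x \<in> space (Pi\<^sub>M I (\<lambda>_. lborel)). \<forall>i\<in>S. (c :: real) \<le> x i} \<in> sets (Pi\<^sub>M I (\<lambda>_. lborel))"
    using assms(1) by (intro sets.sets_Collect_finite_All; measurable)+
qed

context
  fixes I :: "'i set" and F :: "('i \<Rightarrow> real) measure"
  assumes finite: "finite I" and F: "dm_logconcave_distribution I F"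
begin

lemma sigma_pos:
  assumes "i \<in> I"
  shows "0 < sigma F i"
proof -
  obtain f where "dm_density I f" "\<And>i. i \<in> I \<Longrightarrow> dm_density.rms I f i = sigma F i"
    using dm_logconcave_distributionE[OF F finite] by blast
  then show ?thesis using dm_density.rms_pos[of I f i] assms by simp
qed

text \<open>Common reduction for both estimates below: the event depends only on the coordinates in
  \<open>S\<close>, so its probability is an integral of the marginal density. The bound is assumed
  for every density with the right root mean squares because the marginal is known only to
  exist.\<close>

lemma measure_le_marginal:
  assumes S: "S \<subseteq> I" and Q: "{x \<in> space (Pi\<^sub>M I (\<lambda>_. lborel)). Q x} \<in> sets (Pi\<^sub>M I (\<lambda>_. lborel))"
    "{x \<in> space (Pi\<^sub>M S (\<lambda>_. lborel)). Q x} \<in> sets (Pi\<^sub>M S (\<lambda>_. lborel))"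
    and restrict: "\<And>x. Q (restrict x S) \<longleftrightarrow> Q x"
    and c: "0 \<le> c" "\<And>g. dm_density S g \<Longrightarrow> (\<And>i. i \<in> S \<Longrightarrow> dm_density.rms S g i = sigma F i) \<Longrightarrow>
      (\<integral>\<^sup>+x. ennreal (g x) * indicator {x. Q x} x \<partial>Pi\<^sub>M S (\<lambda>_. lborel)) \<le> ennreal c"
  shows "measure F {x \<in> space F. Q x} \<le> c"
proof -
  obtain f where f: "dm_density I f" "F = density (Pi\<^sub>M I (\<lambda>_. lborel)) (\<lambda>x. ennreal (f x))"
    "\<And>i. i \<in> I \<Longrightarrow> dm_density.rms I f i = sigma F i"
    using dm_logconcave_distributionE[OF F finite] by blast
  interpret dm_density I f by fact
  obtain g where g: "dm_density S g" "\<And>i. i \<in> S \<Longrightarrow> dm_density.rms S g i = rms i"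
    "\<And>\<phi>. \<phi> \<in> borel_measurable (Pi\<^sub>M S (\<lambda>_. lborel)) \<Longrightarrow>
       (\<integral>\<^sup>+x. ennreal (f x) * \<phi> (restrict x S) \<partial>Pi\<^sub>M I (\<lambda>_. lborel)) =
       (\<integral>\<^sup>+x. ennreal (g x) * \<phi> x \<partial>Pi\<^sub>M S (\<lambda>_. lborel))"
    using marginal_rms[OF S] by blast
  have "emeasure F {x \<in> space F. Q x} =
    (\<integral>\<^sup>+x. ennreal (f x) * indicator {x \<in> space (Pi\<^sub>M I (\<lambda>_. lborel)). Q x} x \<partial>Pi\<^sub>M I (\<lambda>_. lborel))"
    using Q(1) unfolding f(2) by (subst emeasure_density) auto
  also have "\<dots> = (\<integral>\<^sup>+x. ennreal (f x) * indicator {x. Q x} (restrict x S) \<partial>Pi\<^sub>M I (\<lambda>_. lborel))"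
    by (intro nn_integral_cong) (simp only: indicator_def mem_Collect_eq restrict simp_thms)
  also have "\<dots> = (\<integral>\<^sup>+x. ennreal (g x) * indicator {x. Q x} x \<partial>Pi\<^sub>M S (\<lambda>_. lborel))"
    using Q(2) by (intro g(3)) (simp add: borel_measurable_indicator_iff Int_def conj_commute)
  also have "\<dots> \<le> ennreal c"
    using g(1,2) f(3) S by (intro c(2)) auto
  finally show ?thesis
    using c(1) by (simp add: measure_def enn2real_leI)
qed

lemma measure_all_small_le:
  assumes S: "S \<subseteq> I" and \<sigma>: "0 < \<sigma>" "\<And>i. i \<in> S \<Longrightarrow> \<sigma> \<le> sigma F i" and p: "0 \<le> p"
  shows "measure F {x \<in> space F. \<forall>i\<in>S. x i \<le> p} \<le> (4 * exp 26 * p / \<sigma>) ^ card S"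
proof (rule measure_le_marginal[OF S])
  show "(\<integral>\<^sup>+x. ennreal (g x) * indicator {x. \<forall>i\<in>S. x i \<le> p} x \<partial>Pi\<^sub>M S (\<lambda>_. lborel))
      \<le> ennreal ((4 * exp 26 * p / \<sigma>) ^ card S)"
    if "dm_density S g" "\<And>i. i \<in> S \<Longrightarrow> dm_density.rms S g i = sigma F i" for g
    using that \<sigma> p by (intro dm_density.nn_integral_all_small_le) auto
qed (use S finite \<sigma> p in \<open>auto intro!: sets_Collect_all_coordinates intro: finite_subset\<close>)

lemma measure_all_at_least_le:
  assumes S: "S \<subseteq> I" and \<sigma>: "0 < \<sigma>" "\<And>i. i \<in> S \<Longrightarrow> sigma F i \<le> \<sigma>" and t: "0 \<le> t" "t \<le> 16 * exp 1 * \<sigma>"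
  shows "measure F {x \<in> space F. \<forall>i\<in>S. t \<le> x i} \<le> (1 - t / (32 * exp 1 * \<sigma>)) ^ card S"
proof (rule measure_le_marginal[OF S])
  show "(\<integral>\<^sup>+x. ennreal (g x) * indicator {x. \<forall>i\<in>S. t \<le> x i} x \<partial>Pi\<^sub>M S (\<lambda>_. lborel))
      \<le> ennreal ((1 - t / (32 * exp 1 * \<sigma>)) ^ card S)"
    if "dm_density S g" "\<And>i. i \<in> S \<Longrightarrow> dm_density.rms S g i = sigma F i" for g
    using that \<sigma> t by (intro dm_density.nn_integral_all_at_least_le) auto
  have "t / (32 * exp 1 * \<sigma>) \<le> 1" using \<sigma>(1) t by (simp add: field_simps)
  then show "0 \<le> (1 - t / (32 * exp 1 * \<sigma>)) ^ card S" by simp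
qed (use S finite in \<open>auto intro!: sets_Collect_all_coordinates intro: finite_subset\<close>)

end

section \<open>Cuts and connectedness\<close>

definition cut :: "nat \<Rightarrow> nat set \<Rightarrow> (nat \<times> nat) set" where
  "cut n W = {e \<in> vertex_pairs n. fst e \<in> W \<longleftrightarrow> snd e \<notin> W}"

lemma cut_subset: "cut n W \<subseteq> vertex_pairs n"
  by (auto simp: cut_def)

lemma cut_complement: "cut n ({1..n} - W) = cut n W"
  by (auto simp: cut_def vertex_pairs_def)

text \<open>A vertex of \<open>W\<close> and one outside are sent to their increasing pair. This is
  injective because the endpoint in \<open>W\<close> can be recovered.\<close>

lemma card_cut_ge:
  assumes W: "W \<subseteq> {1..n}"
  shows "card W * (n - card W) \<le> card (cut n W)"
proof -
  have "card W * (n - card W) = card (W \<times> ({1..n} - W))"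
    using W by (simp add: card_cartesian_product card_Diff_subset finite_subset)
  also have "\<dots> \<le> card (cut n W)"
  proof (rule card_inj_on_le)
    show "inj_on (\<lambda>(a, b). (min a b, max a b)) (W \<times> ({1..n} - W))"
      by (auto simp: inj_on_def min_def max_def split: if_splits)
    show "(\<lambda>(a, b). (min a b, max a b)) ` (W \<times> ({1..n} - W)) \<subseteq> cut n W"
    proof clarify
      fix a b assume ab: "a \<in> W" "b \<in> {1..n}" "b \<notin> W"
      then have "a < b \<or> b < a" by (metis linorder_neqE_nat)
      then show "(min a b, max a b) \<in> cut n W"
        using ab W by (auto simp: cut_def vertex_pairs_def)
    qed
    show "finite (cut n W)" using finite_subset[OF cut_subset finite_vertex_pairs] .
  qed
  finally show ?thesis .
qed

text \<open>A walk leaving \<open>W\<close> must cross its cut; conversely, no edge crosses the cut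
  of the set of vertices reachable from u, which is therefore everything. Since there are finitely
  many cuts, this also exhibits connectedness as a finite combination of coordinate events, hence as
  measurable.\<close>

lemma connected_threshold_graph_iff:
  assumes n: "1 \<le> n"
  shows "Digraph_Component.connected (with_proj (threshold_graph n x p)) \<longleftrightarrow>
    (\<forall>W. W \<subseteq> {1..n} \<longrightarrow> W \<noteq> {} \<longrightarrow> W \<noteq> {1..n} \<longrightarrow> (\<exists>e\<in>cut n W. x e \<le> p))"
    (is "?conn \<longleftrightarrow> ?cuts")
proof -
  define R where "R = symcl (parcs (threshold_graph n x p))"
  have R: "(u, v) \<in> R \<longleftrightarrow> (u, v) \<in> vertex_pairs n \<and> x (u, v) \<le> p \<or> (v, u) \<in> vertex_pairs n \<and> x (v, u) \<le> p" for u v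
    by (auto simp: R_def symcl_def threshold_graph_def)
  have "pverts (threshold_graph n x p) = {1..n}" by (simp add: threshold_graph_def)
  then have conn: "?conn \<longleftrightarrow> (\<forall>u\<in>{1..n}. \<forall>v\<in>{1..n}. (u, v) \<in> rtrancl_on {1..n} R)"
    using n unfolding connected_conv by (simp add: R_def)
  show ?thesis
  proof
    assume ?conn
    show ?cuts
    proof (intro allI impI)
      fix W assume W: "W \<subseteq> {1..n}" "W \<noteq> {}" "W \<noteq> {1..n}"
      then obtain u v where uv: "u \<in> W" "v \<in> {1..n} - W" by blast
      show "\<exists>e\<in>cut n W. x e \<le> p"
      proof (rule ccontr)
        assume none: "\<not> (\<exists>e\<in>cut n W. x e \<le> p)"
        have "(u, v) \<in> rtrancl_on {1..n} R" using \<open>?conn\<close> uv W unfolding conn by blast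
        then have "v \<in> W"
        proof (induction rule: rtrancl_on_induct)
          case base
          then show ?case using uv by simp
        next
          case (step y z)
          then show ?case using none by (auto simp: R cut_def)
        qed
        with uv show False by simp
      qed
    qed
  next
    assume cuts: ?cuts
    show ?conn
      unfolding conn
    proof (intro ballI)
      fix u v assume uv: "u \<in> {1..n}" "v \<in> {1..n}"
      define W where "W = {w. (u, w) \<in> rtrancl_on {1..n} R}"
      have W: "W \<subseteq> {1..n}" "u \<in> W"
        using uv by (auto simp: W_def dest: in_rtrancl_on_in_F)
      have "W = {1..n}"
      proof (rule ccontr)
        assume "W \<noteq> {1..n}"
        with cuts W obtain e where e: "e \<in> cut n W" "x e \<le> p" by blast
        obtain a b where ab: "e = (a, b)" by (cases e)
        have "(a, b) \<in> R" "(b, a) \<in> R" "a \<in> {1..n}" "b \<in> {1..n}"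
          using e by (auto simp: ab R cut_def vertex_pairs_def)
        then have "a \<in> W \<longleftrightarrow> b \<in> W"
          by (auto simp: W_def intro: rtrancl_on_into_rtrancl_on)
        then show False using e by (auto simp: ab cut_def)
      qed
      then show "(u, v) \<in> rtrancl_on {1..n} R" using uv by (auto simp: W_def)
    qed
  qed
qed

text \<open>A vertex set is grown from a single vertex. Each step crosses its cut along an edge that
  lies inside the enlarged set but not inside the old one, so edges are counted without a spanning
  tree.\<close>

lemma connected_threshold_graph_card_ge:
  assumes n: "1 \<le> n" and conn: "Digraph_Component.connected (with_proj (threshold_graph n x p))"
  shows "n - 1 \<le> card {e \<in> vertex_pairs n. x e \<le> p}"
proof -
  define E where "E = {e \<in> vertex_pairs n. x e \<le> p}"
  have fin: "finite E" using finite_vertex_pairs[of n] by (simp add: E_def)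
  have "\<exists>W. W \<subseteq> {1..n} \<and> card W = Suc m \<and> m \<le> card {e \<in> E. fst e \<in> W \<and> snd e \<in> W}" if "Suc m \<le> n" for m
    using that
  proof (induction m)
    case 0
    then show ?case by (intro exI[of _ "{1}"]) auto
  next
    case (Suc m)
    then obtain W where W: "W \<subseteq> {1..n}" "card W = Suc m" "m \<le> card {e \<in> E. fst e \<in> W \<and> snd e \<in> W}"
      by auto
    have finW: "finite W" using W(1) finite_subset by blast
    have "W \<noteq> {1..n}" "W \<noteq> {}" using W(2) Suc.prems by auto
    then obtain e where e: "e \<in> cut n W" "x e \<le> p"
      using conn W(1) unfolding connected_threshold_graph_iff[OF n] by blast
    obtain a b where ab: "e = (a, b)" by (cases e)
    \<comment> \<open>The endpoint of \<open>e\<close> outside \<open>W\<close>.\<close>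
    define c where "c = (if a \<in> W then b else a)"
    have "a \<in> W \<longleftrightarrow> b \<notin> W" "a \<in> {1..n}" "b \<in> {1..n}" "e \<in> E"
      using e by (auto simp: ab cut_def E_def vertex_pairs_def)
    then have c: "c \<notin> W" "c \<in> {1..n}" "e \<in> E" "a \<in> insert c W" "b \<in> insert c W"
      by (cases "a \<in> W"; simp add: c_def)+
    have "Suc m \<le> card (insert e {e \<in> E. fst e \<in> W \<and> snd e \<in> W})"
      using W(3) fin e(1) by (subst card_insert_disjoint) (auto simp: cut_def)
    also have "\<dots> \<le> card {e \<in> E. fst e \<in> insert c W \<and> snd e \<in> insert c W}"
      using fin c by (intro card_mono) (auto simp: ab)
    finally have "Suc m \<le> card {e \<in> E. fst e \<in> insert c W \<and> snd e \<in> insert c W}" .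
    moreover have "insert c W \<subseteq> {1..n}" "card (insert c W) = Suc (Suc m)"
      using W c finW by auto
    ultimately show ?case by blast
  qed
  from this[of "n - 1"] n obtain W where "n - 1 \<le> card {e \<in> E. fst e \<in> W \<and> snd e \<in> W}" by auto
  also have "\<dots> \<le> card E" using fin by (intro card_mono) auto
  finally show ?thesis by (simp add: E_def)
qed

text \<open>The quotient m^m / m! is one term of the series of exp m.\<close>

lemma power_self_le_exp_mult_fact: "real m ^ m \<le> exp (real m) * fact m"
proof -
  have "(\<Sum>k\<in>{m}. inverse (fact k) * real m ^ k) \<le> (\<Sum>k. inverse (fact k) * real m ^ k)"
    by (intro sum_le_suminf summable_exp) auto
  also have "\<dots> = exp (real m)" by (simp add: exp_def)
  finally show ?thesis by (simp add: field_simps)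
qed

section \<open>The threshold\<close>

text \<open>A connected graph contains some set of m = n - 1 edges. From at most nm/2 pairs there
  are at most (nm/2)^m / m! \<le> (e n / 2)^m such sets. Each is present with probability at most
  (1/(e n))^m, the 27 = 26 + 1 in the constant supplying this extra factor e. The product is
  2^(-m).\<close>

lemma prob_connected_le:
  assumes n: "2 \<le> n" and F: "dm_logconcave_distribution (vertex_pairs n) F"
    and p: "p < 1 / (4 * exp 27) * sigma_min (vertex_pairs n) F / real n"
  shows "prob_connected n F p \<le> (1/2) ^ (n - 1)"
proof -
  interpret prob_space F using F by (simp add: dm_logconcave_distribution_def)
  define m where "m = n - 1"
  have m: "0 < m" "real n = real m + 1" using n by (auto simp: m_def)
  define \<sigma> where "\<sigma> = sigma_min (vertex_pairs n) F"
  \<comment> \<open>\<open>p\<close> itself may be negative, whereas the box estimate requires a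
    nonnegative level; enlarging \<open>p\<close> to \<open>q\<close> also makes the bound
    explicit.\<close>
  define q where "q = 1 / (4 * exp 27) * \<sigma> / real n"
  note fin = finite_vertex_pairs[of n]
  have "(1, 2) \<in> vertex_pairs n" using n by (auto simp: vertex_pairs_def)
  then have ne: "vertex_pairs n \<noteq> {}" by auto
  have \<sigma>_le: "\<sigma> \<le> sigma F e" if "e \<in> vertex_pairs n" for e
    using that fin by (simp add: \<sigma>_def sigma_min_def)
  have "\<sigma> \<in> sigma F ` vertex_pairs n"
    unfolding \<sigma>_def sigma_min_def using fin ne by (intro Min_in) auto
  then have \<sigma>_pos: "0 < \<sigma>" using sigma_pos[OF fin F] by auto
  have q0: "0 \<le> q" using \<sigma>_pos by (simp add: q_def)
  define \<S> where "\<S> = {S. S \<subseteq> vertex_pairs n \<and> card S = m}"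
  have fin\<S>: "finite \<S>" using fin by (simp add: \<S>_def)
  have meas: "{x \<in> space F. \<forall>e\<in>S. x e \<le> q} \<in> sets F" if S: "S \<in> \<S>" for S
  proof -
    obtain f where "F = density (Pi\<^sub>M (vertex_pairs n) (\<lambda>_. lborel)) f"
      using F by (auto simp: dm_logconcave_distribution_def)
    then show ?thesis
      using sets_Collect_all_coordinates(1)[of S "vertex_pairs n" q] S fin
      by (auto simp: \<S>_def finite_subset)
  qed
  have "prob_connected n F p \<le> measure F (\<Union>S\<in>\<S>. {x \<in> space F. \<forall>e\<in>S. x e \<le> q})"
    unfolding prob_connected_def
  proof (rule finite_measure_mono)
    show "(\<Union>S\<in>\<S>. {x \<in> space F. \<forall>e\<in>S. x e \<le> q}) \<in> sets F" using fin\<S> meas by auto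
    show "{x \<in> space F. Digraph_Component.connected (with_proj (threshold_graph n x p))}
      \<subseteq> (\<Union>S\<in>\<S>. {x \<in> space F. \<forall>e\<in>S. x e \<le> q})"
    proof safe
      fix x assume "x \<in> space F" "Digraph_Component.connected (with_proj (threshold_graph n x p))"
      then have "m \<le> card {e \<in> vertex_pairs n. x e \<le> p}"
        using connected_threshold_graph_card_ge[of n x p] n by (simp add: m_def)
      then obtain S where S: "S \<subseteq> {e \<in> vertex_pairs n. x e \<le> p}" "card S = m"
        by (rule obtain_subset_with_card_n)
      have "p < q" using p by (simp add: q_def \<sigma>_def)
      then have "x e \<le> q" if "e \<in> S" for e using S(1) that by fastforce
      moreover have "S \<in> \<S>" using S by (auto simp: \<S>_def)
      ultimately show "x \<in> (\<Union>S\<in>\<S>. {x \<in> space F. \<forall>e\<in>S. x e \<le> q})"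
        using \<open>x \<in> space F\<close> by blast
    qed
  qed
  also have "\<dots> \<le> (\<Sum>S\<in>\<S>. measure F {x \<in> space F. \<forall>e\<in>S. x e \<le> q})"
    using fin\<S> meas by (intro finite_measure_subadditive_finite) auto
  also have "\<dots> \<le> (\<Sum>S\<in>\<S>. (4 * exp 26 * q / \<sigma>) ^ m)"
  proof (rule sum_mono)
    fix S assume "S \<in> \<S>"
    then show "measure F {x \<in> space F. \<forall>e\<in>S. x e \<le> q} \<le> (4 * exp 26 * q / \<sigma>) ^ m"
      using measure_all_small_le[OF fin F, of S \<sigma> q] \<sigma>_pos \<sigma>_le q0 by (auto simp: \<S>_def)
  qed
  also have "\<dots> = real (card (vertex_pairs n) choose m) * (4 * exp 26 * q / \<sigma>) ^ m"
    using n_subsets[OF fin, of m] by (simp add: \<S>_def)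
  also have "4 * exp 26 * q / \<sigma> = 1 / (exp 1 * real n)"
  proof -
    have "exp 27 = exp 26 * exp (1 :: real)" by (simp flip: exp_add)
    then show ?thesis using \<sigma>_pos by (simp add: q_def)
  qed
  also have "real (card (vertex_pairs n) choose m) * (1 / (exp 1 * real n)) ^ m \<le> (1/2) ^ m"
  proof -
    define N where "N = card (vertex_pairs n)"
    have "2 * N \<le> n * m" by (simp add: N_def card_vertex_pairs m_def)
    then have "real (2 * N) \<le> real (n * m)" by (rule of_nat_mono)
    then have N: "real N \<le> real n * real m / 2" by simp
    have "real (N choose m) * fact m \<le> real N ^ m"
      using binomial_fact_pow[of N m] by (metis of_nat_fact of_nat_le_iff of_nat_mult of_nat_power)
    also have "\<dots> \<le> (real n * real m / 2) ^ m" using N by (intro power_mono) auto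
    also have "\<dots> = (real n / 2) ^ m * real m ^ m" by (simp add: power_mult_distrib power_divide)
    also have "\<dots> \<le> (real n / 2) ^ m * (exp (real m) * fact m)"
      by (intro mult_left_mono power_self_le_exp_mult_fact) auto
    finally have "real (N choose m) \<le> (real n / 2) ^ m * exp (real m)"
      by simp
    also have "exp (real m) = exp 1 ^ m" using exp_of_nat_mult[of m "1 :: real"] by simp
    finally have "real (N choose m) * (1 / (exp 1 * real n)) ^ m
      \<le> ((real n / 2) ^ m * exp 1 ^ m) * (1 / (exp 1 * real n)) ^ m"
      by (rule mult_right_mono) auto
    also have "\<dots> = ((real n / 2) * exp 1 * (1 / (exp 1 * real n))) ^ m"
      by (simp only: power_mult_distrib)
    also have "(real n / 2) * exp 1 * (1 / (exp 1 * real n)) = 1 / 2" using n by simp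
    finally show ?thesis by (simp add: N_def)
  qed
  finally show ?thesis by (simp add: m_def)
qed

text \<open>Disconnectedness makes all edges of some cut long. The condition 8 ln n \<le> n keeps
  the level \<open>q\<close> within the range 16 e \<sigma> of the tail estimate. Summing n^(-2|W|)
  over all nonempty vertex sets gives (1 + n^(-2))^n - 1, at most exp(1/n) - 1.\<close>

lemma prob_connected_ge:
  assumes n: "2 \<le> n" "8 * ln (real n) \<le> real n" and F: "dm_logconcave_distribution (vertex_pairs n) F"
    and p: "p > 128 * exp 1 * sigma_max (vertex_pairs n) F * ln (real n) / real n"
  shows "prob_connected n F p \<ge> 2 - exp (1 / real n)"
proof -
  interpret prob_space F using F by (simp add: dm_logconcave_distribution_def)
  define \<sigma> where "\<sigma> = sigma_max (vertex_pairs n) F"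
  \<comment> \<open>128 = 4 * 32, so that each edge of a cut contributes the factor 1 - 4 ln n /
    n.\<close>
  define q where "q = 128 * exp 1 * \<sigma> * ln (real n) / real n"
  note fin = finite_vertex_pairs[of n]
  have "(1, 2) \<in> vertex_pairs n" using n by (auto simp: vertex_pairs_def)
  then have ne: "vertex_pairs n \<noteq> {}" by auto
  have \<sigma>_ge: "sigma F e \<le> \<sigma>" if "e \<in> vertex_pairs n" for e
    using that fin by (simp add: \<sigma>_def sigma_max_def)
  have "\<sigma> \<in> sigma F ` vertex_pairs n"
    unfolding \<sigma>_def sigma_max_def using fin ne by (intro Max_in) auto
  then have \<sigma>_pos: "0 < \<sigma>" using sigma_pos[OF fin F] by auto
  have ln_n: "0 < ln (real n)" using n by simp
  have q0: "0 \<le> q" using \<sigma>_pos ln_n by (simp add: q_def)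
  have q_ratio: "q / (32 * exp 1 * \<sigma>) = 4 * ln (real n) / real n"
    using \<sigma>_pos by (simp add: q_def)
  have q_le: "q \<le> 16 * exp 1 * \<sigma>"
  proof -
    have "q = 16 * exp 1 * \<sigma> * (8 * ln (real n) / real n)" by (simp add: q_def)
    also have "\<dots> \<le> 16 * exp 1 * \<sigma> * 1"
      using n \<sigma>_pos by (intro mult_left_mono) auto
    finally show ?thesis by simp
  qed
  \<comment> \<open>A set and its complement have the same cut, so the smaller side suffices. The
    other side then has at least n/2 vertices, and the cut at least n |W| / 2 edges.\<close>
  define \<W> where "\<W> = {W. W \<subseteq> {1..n} \<and> W \<noteq> {} \<and> 2 * card W \<le> n}"
  have fin\<W>: "finite \<W>" by (simp add: \<W>_def)
  obtain f where F_eq: "F = density (Pi\<^sub>M (vertex_pairs n) (\<lambda>_. lborel)) f"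
    using F by (auto simp: dm_logconcave_distribution_def)
  have coord: "(\<lambda>x. x e) \<in> borel_measurable F" if "e \<in> vertex_pairs n" for e
    using measurable_component_singleton[OF that, of "\<lambda>_. lborel :: real measure"] by (simp add: F_eq)
  have fin_cut: "finite (cut n W)" for W using finite_subset[OF cut_subset fin] .
  have meas: "{x \<in> space F. \<forall>e\<in>cut n W. q \<le> x e} \<in> sets F" for W
    using sets_Collect_all_coordinates(2)[OF fin_cut[of W] cut_subset[of n W], of q] by (simp add: F_eq)
  let ?C = "\<lambda>x. Digraph_Component.connected (with_proj (threshold_graph n x p))"
  \<comment> \<open>Measurability of the event itself is required here, since its probability is
    computed through the complement.\<close>
  have C_sets: "{x \<in> space F. ?C x} \<in> sets F"
  proof -
    have eq: "?C x \<longleftrightarrow> (\<forall>W\<in>{W. W \<subseteq> {1..n} \<and> W \<noteq> {} \<and> W \<noteq> {1..n}}. \<exists>e\<in>cut n W. x e \<le> p)" for x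
      using connected_threshold_graph_iff[of n x p] n by auto
    have "{x \<in> space F. x e \<le> p} \<in> sets F" if "e \<in> cut n W" for e W
      using that cut_subset by (intro borel_measurable_le coord) auto
    moreover have "finite {W. W \<subseteq> {1..n} \<and> W \<noteq> {} \<and> W \<noteq> {1..n}}"
      by (rule finite_subset[of _ "Pow {1..n}"]) auto
    ultimately show ?thesis
      unfolding eq using fin_cut
      by (intro sets.sets_Collect_finite_All sets.sets_Collect_finite_Ex) blast+
  qed
  have "1 - prob_connected n F p = measure F {x \<in> space F. \<not> ?C x}"
    unfolding prob_connected_def using C_sets prob_neg[of ?C] by simp
  also have "\<dots> \<le> measure F (\<Union>W\<in>\<W>. {x \<in> space F. \<forall>e\<in>cut n W. q \<le> x e})"
  proof (rule finite_measure_mono)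
    show "(\<Union>W\<in>\<W>. {x \<in> space F. \<forall>e\<in>cut n W. q \<le> x e}) \<in> sets F" using fin\<W> meas by auto
    show "{x \<in> space F. \<not> ?C x} \<subseteq> (\<Union>W\<in>\<W>. {x \<in> space F. \<forall>e\<in>cut n W. q \<le> x e})"
    proof safe
      fix x assume x: "x \<in> space F" "\<not> ?C x"
      then obtain W where W: "W \<subseteq> {1..n}" "W \<noteq> {}" "W \<noteq> {1..n}" "\<forall>e\<in>cut n W. \<not> x e \<le> p"
        using connected_threshold_graph_iff[of n x p] n by auto
      \<comment> \<open>An absent edge has length above \<open>p\<close>, hence at least the
        explicit level \<open>q\<close>.\<close>
      have "q < p" using p by (simp add: q_def \<sigma>_def)
      then have W_cut: "\<forall>e\<in>cut n W. q \<le> x e" using W(4) by force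
      have "card ({1..n} - W) = n - card W"
        using W(1) by (simp add: card_Diff_subset finite_subset)
      then have "W \<in> \<W> \<or> {1..n} - W \<in> \<W>"
        using W(1-3) by (auto simp: \<W>_def)
      moreover have "\<forall>e\<in>cut n ({1..n} - W). q \<le> x e"
        unfolding cut_complement by (rule W_cut)
      ultimately show "x \<in> (\<Union>W\<in>\<W>. {x \<in> space F. \<forall>e\<in>cut n W. q \<le> x e})"
        using W_cut x(1) by blast
    qed
  qed
  also have "\<dots> \<le> (\<Sum>W\<in>\<W>. measure F {x \<in> space F. \<forall>e\<in>cut n W. q \<le> x e})"
    using fin\<W> meas by (intro finite_measure_subadditive_finite) auto
  also have "\<dots> \<le> (\<Sum>W\<in>\<W>. (1 / (real n)\<^sup>2) ^ card W)"
  proof (rule sum_mono)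
    fix W assume W: "W \<in> \<W>"
    define y where "y = 4 * ln (real n) / real n"
    have y: "0 \<le> y" "y \<le> 1" using n ln_n by (auto simp: y_def)
    have "measure F {x \<in> space F. \<forall>e\<in>cut n W. q \<le> x e} \<le> (1 - y) ^ card (cut n W)"
      using measure_all_at_least_le[OF fin F cut_subset[of n W] \<sigma>_pos, of q] \<sigma>_ge q0 q_le cut_subset[of n W]
      by (auto simp: q_ratio y_def)
    also have "\<dots> \<le> exp (- y) ^ card (cut n W)"
      using exp_ge_add_one_self[of "- y"] y by (intro power_mono) auto
    also have "\<dots> = exp (- (y * real (card (cut n W))))"
      by (simp add: exp_of_nat_mult[symmetric] mult.commute)
    also have "\<dots> \<le> exp (- (2 * ln (real n) * real (card W)))"
    proof -
      have "real n \<le> 2 * real (n - card W)" using W by (simp add: \<W>_def)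
      then have "real (card W) * real n \<le> real (card W) * (2 * real (n - card W))"
        by (intro mult_left_mono) auto
      also have "\<dots> = 2 * real (card W * (n - card W))" by simp
      also have "\<dots> \<le> 2 * real (card (cut n W))"
        using card_cut_ge[of W n] W by (intro mult_left_mono of_nat_mono) (auto simp: \<W>_def)
      finally have "2 * ln (real n) / real n * (real (card W) * real n)
          \<le> 2 * ln (real n) / real n * (2 * real (card (cut n W)))"
        using ln_n by (intro mult_left_mono) auto
      then show ?thesis using n by (simp add: y_def)
    qed
    also have "\<dots> = (1 / (real n)\<^sup>2) ^ card W"
    proof -
      have "exp (- (2 * ln (real n))) = 1 / (real n)\<^sup>2"
        using n by (simp add: exp_minus exp_double field_simps)
      moreover have "exp (- (2 * ln (real n) * real (card W))) = exp (- (2 * ln (real n))) ^ card W"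
        using exp_of_nat_mult[of "card W" "- (2 * ln (real n))"] by (simp add: mult.commute)
      ultimately show ?thesis by simp
    qed
    finally show "measure F {x \<in> space F. \<forall>e\<in>cut n W. q \<le> x e} \<le> (1 / (real n)\<^sup>2) ^ card W" .
  qed
  also have "\<dots> \<le> (\<Sum>W\<in>Pow {1..n} - {{}}. (1 / (real n)\<^sup>2) ^ card W)"
    by (intro sum_mono2) (auto simp: \<W>_def)
  also have "\<dots> = (\<Sum>W\<in>Pow {1..n}. (1 / (real n)\<^sup>2) ^ card W) - 1"
    by (subst sum_diff) auto
  also have "(\<Sum>W\<in>Pow {1..n}. (1 / (real n)\<^sup>2) ^ card W) = (1 / (real n)\<^sup>2 + 1) ^ n"
    using prod_add[of "{1..n}" "\<lambda>_. 1 / (real n)\<^sup>2" "\<lambda>_. 1"] by simp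
  also have "\<dots> \<le> exp (1 / (real n)\<^sup>2) ^ n"
    using exp_ge_add_one_self[of "1 / (real n)\<^sup>2"] by (intro power_mono) (auto simp: add.commute)
  also have "\<dots> = exp (1 / real n)"
    using n by (simp add: exp_of_nat_mult[symmetric] power2_eq_square)
  finally show ?thesis by simp
qed

text \<open>From n = 2 on there is at least one pair, so \<open>Min\<close> and \<open>Max\<close>
  in \<open>sigma_min\<close> and \<open>sigma_max\<close> are taken over nonempty sets. The
  explicit bounds 2^(-(n-1)) and 2 - exp(1/n) give the two limits.\<close>

theorem theorem2p1:
  shows "\<exists>c1 c2 :: real. 0 < c1 \<and> c1 < c2 \<and>
    (\<forall>(F :: nat \<Rightarrow> (nat \<times> nat \<Rightarrow> real) measure) (p :: nat \<Rightarrow> real).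
      (\<forall>n\<ge>2. dm_logconcave_distribution (vertex_pairs n) (F n)) \<longrightarrow>
      ((\<forall>\<^sub>F n in sequentially. p n < c1 * sigma_min (vertex_pairs n) (F n) / real n) \<longrightarrow>
         (\<lambda>n. prob_connected n (F n) (p n)) \<longlonglongrightarrow> 0) \<and>
      ((\<forall>\<^sub>F n in sequentially. p n > c2 * sigma_max (vertex_pairs n) (F n) * ln (real n) / real n) \<longrightarrow>
         (\<lambda>n. prob_connected n (F n) (p n)) \<longlonglongrightarrow> 1))"
proof (rule exI[of _ "1 / (4 * exp 27)"], rule exI[of _ "128 * exp 1"], intro conjI allI impI)
  show "0 < 1 / (4 * exp (27 :: real))" by simp
  have "1 * 1 \<le> exp 27 * exp (1 :: real)" by (intro mult_mono) auto
  then show "1 / (4 * exp 27) < 128 * exp (1 :: real)" by (simp add: field_simps)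
next
  fix F :: "nat \<Rightarrow> (nat \<times> nat \<Rightarrow> real) measure" and p :: "nat \<Rightarrow> real"
  assume F: "\<forall>n\<ge>2. dm_logconcave_distribution (vertex_pairs n) (F n)"
  { assume p: "\<forall>\<^sub>F n in sequentially. p n < 1 / (4 * exp 27) * sigma_min (vertex_pairs n) (F n) / real n"
    show "(\<lambda>n. prob_connected n (F n) (p n)) \<longlonglongrightarrow> 0"
    proof (rule tendsto_sandwich)
      show "\<forall>\<^sub>F n in sequentially. 0 \<le> prob_connected n (F n) (p n)"
        by (simp add: prob_connected_def)
      show "\<forall>\<^sub>F n in sequentially. prob_connected n (F n) (p n) \<le> (1/2) ^ (n - 1)"
        using p eventually_ge_at_top[of 2] by eventually_elim (use F prob_connected_le in blast)
      show "(\<lambda>n. (1/2 :: real) ^ (n - 1)) \<longlonglongrightarrow> 0" by real_asymp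
    qed simp
  }
  { assume p: "\<forall>\<^sub>F n in sequentially. p n > 128 * exp 1 * sigma_max (vertex_pairs n) (F n) * ln (real n) / real n"
    show "(\<lambda>n. prob_connected n (F n) (p n)) \<longlonglongrightarrow> 1"
    proof (rule tendsto_sandwich)
      have "\<forall>\<^sub>F n in sequentially. 8 * ln (real n) \<le> real n" by real_asymp
      with p eventually_ge_at_top[of 2] show "\<forall>\<^sub>F n in sequentially. 2 - exp (1 / real n) \<le> prob_connected n (F n) (p n)"
        by eventually_elim (use F prob_connected_ge in blast)
      show "\<forall>\<^sub>F n in sequentially. prob_connected n (F n) (p n) \<le> 1"
        using eventually_ge_at_top[of 2]
      proof eventually_elim
        case (elim n)
        then have "prob_space (F n)" using F by (auto simp: dm_logconcave_distribution_def)
        then show ?case unfolding prob_connected_def by (rule prob_space.prob_le_1)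
      qed
      show "(\<lambda>n. 2 - exp (1 / real n)) \<longlonglongrightarrow> 1" by real_asymp
    qed simp
  }
qed

end
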